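(* Let $\delta>0$ and let $q\in L^\infty(t_0,+\infty)$ for some $t_0\in\mathbb{R}$. Assume that: - there exists $\eta>0$ for which $q(t)\ge\eta$ for almost every $t\in\,]t_0,+\infty[$; - there exists $c>0$ for which $q\equiv c$ in $]-\infty,t_0]$. Let $f\colon[0,1]\to\mathbb{R}$ be a Lipschitz continuous function such that $f(0)=f(1)=0$ and there exists $\alpha\in\,]0,1[$ with $f(\alpha)=0$, $f(s)<0$ for all $s\in\,]0,\alpha[$ and $f(s)>0$ for all $s\in\,]\alpha,1[$. Let $F(v)=\int_0^v f(s)\,\mathrm{d}s$ and assume $F(1)>0$. Then, if $$c\ge\|q\|_{L^\infty(t_0,+\infty)}\,\frac{F(1)-F(\alpha)}{-F(\alpha)},$$ there exists a strictly increasing heteroclinic solution of $$\delta\bigl(\phi(v'(t))\bigr)'+q(t)f(v(t))=0,\quad t\in\mathbb{R}.$$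
   Context: $\phi(\xi)=\dfrac{\xi}{\sqrt{1-\xi^2}}$ for $\xi\in\,]-1,1[$. A solution is a continuously differentiable function $v\colon\mathbb{R}\to[0,1]$, with $v'$ absolutely continuous, which satisfies the equation almost everywhere. A heteroclinic solution is a solution $v$ which is strictly increasing with $\lim_{t\to-\infty}v(t)=0$ and $\lim_{t\to+\infty}v(t)=1$. *)

theory Defs
  imports "HOL-Analysis.Analysis" "HOL-Probability.Essential_Supremum"
begin

text \<open>The curvature operator of the equation; only its values on \<open>{-1<..<1}\<close> are meaningful.\<close>

definition phi :: "real \<Rightarrow> real" where
  "phi \<xi> = \<xi> / sqrt (1 - \<xi>\<^sup>2)"

text \<open>
  The set \<open>I\<close> of pairs of endpoints stands for a finite family of non-overlapping subintervals.
  On \<open>UNIV\<close> this is absolute continuity on the whole line, not merely on compact intervals.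
\<close>

definition absolutely_continuous_on :: "real set \<Rightarrow> (real \<Rightarrow> real) \<Rightarrow> bool" where
  "absolutely_continuous_on S g \<longleftrightarrow>
     (\<forall>\<epsilon>>0. \<exists>\<delta>>0. \<forall>I :: (real \<times> real) set.
        finite I \<and> (\<forall>(a, b)\<in>I. a < b \<and> {a..b} \<subseteq> S) \<and>
        disjoint_family_on (\<lambda>(a, b). {a<..<b}) I \<and> (\<Sum>(a, b)\<in>I. b - a) < \<delta>
        \<longrightarrow> (\<Sum>(a, b)\<in>I. \<bar>g b - g a\<bar>) < \<epsilon>)"

definition Linf_norm :: "real set \<Rightarrow> (real \<Rightarrow> real) \<Rightarrow> ereal" where
  "Linf_norm S q = esssup (lebesgue_on S) (\<lambda>t. ereal \<bar>q t\<bar>)"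

definition in_Linf :: "real set \<Rightarrow> (real \<Rightarrow> real) \<Rightarrow> bool" where
  "in_Linf S q \<longleftrightarrow> q \<in> borel_measurable (lebesgue_on S) \<and> Linf_norm S q < \<infinity>"

text \<open>
  Solutions of \<open>\<delta> (\<phi>(v'))' + q f(v) = 0\<close> on the whole line. The bound \<open>\<bar>v'\<bar> < 1\<close> says that \<open>v'\<close>
  takes values in the domain of \<open>\<phi>\<close>, which the total function \<^const>\<open>phi\<close> does not enforce.
  The derivative of \<open>\<phi>(v')\<close> is required to exist almost everywhere.
\<close>

definition is_solution ::
    "real \<Rightarrow> (real \<Rightarrow> real) \<Rightarrow> (real \<Rightarrow> real) \<Rightarrow> (real \<Rightarrow> real) \<Rightarrow> bool" where
  "is_solution \<delta> q f v \<longleftrightarrow>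
     range v \<subseteq> {0..1} \<and>
     v C1_differentiable_on UNIV \<and>
     absolutely_continuous_on UNIV (deriv v) \<and>
     (\<forall>t. \<bar>deriv v t\<bar> < 1) \<and>
     (AE t in lebesgue. \<exists>D. ((\<lambda>s. phi (deriv v s)) has_real_derivative D) (at t) \<and>
        \<delta> * D + q t * f (v t) = 0)"

definition is_heteroclinic_solution ::
    "real \<Rightarrow> (real \<Rightarrow> real) \<Rightarrow> (real \<Rightarrow> real) \<Rightarrow> (real \<Rightarrow> real) \<Rightarrow> bool" where
  "is_heteroclinic_solution \<delta> q f v \<longleftrightarrow>
     is_solution \<delta> q f v \<and> strict_mono v \<and> (v \<longlongrightarrow> 0) at_bot \<and> (v \<longlongrightarrow> 1) at_top"

end

theory Submission
  imports Defs
begin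

text \<open>
  With \<open>w = \<phi>(v')\<close> the equation becomes the first-order system \<open>v' = \<psi>(w)\<close>, \<open>w' = - (q / \<delta>) f(v)\<close>, where
  \<open>\<psi> = \<phi>\<^sup>-\<^sup>1\<close> is globally Lipschitz and \<open>sqrt (1 + w\<^sup>2)\<close> plays the role of the kinetic energy. Up to
  time \<open>t0\<close> the solution must follow the autonomous orbit that leaves \<open>0\<close>, so it is determined by the
  level \<open>a = v(t0)\<close>. We shoot in \<open>a \<in> [\<alpha>, z]\<close>, where \<open>z\<close> is the zero of \<open>F\<close> in \<open>]\<alpha>, 1[\<close>. The levels whose
  solution turns back (\<open>w < 0\<close>) before reaching \<open>1\<close> and those whose solution crosses \<open>1\<close> with \<open>w > 0\<close> form
  disjoint open sets. The level \<open>z\<close>, with \<open>w = 0\<close>, is in the first set; the level \<open>\<alpha>\<close> is not, since the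
  hypothesis on \<open>c\<close> gives it enough kinetic energy to climb from \<open>F(\<alpha>)\<close> to \<open>F(1)\<close>. By connectedness some level
  belongs to neither set, and its solution increases to \<open>1\<close>.
\<close>

subsection \<open>The first-order system\<close>

definition psi :: "real \<Rightarrow> real" where
  "psi w = w / sqrt (1 + w\<^sup>2)"

lemma one_plus_square_pos [simp]: "0 < 1 + (w::real)\<^sup>2"
  by (smt (verit) zero_le_power2)

lemma one_plus_square_neq0 [simp]: "1 + (w::real)\<^sup>2 \<noteq> 0" "\<not> 1 + (w::real)\<^sup>2 < 0"
  using one_plus_square_pos[of w] by linarith+

lemma sqrt_one_plus_square_pos [simp]: "0 < sqrt (1 + (w::real)\<^sup>2)"
  by simp

lemma sqrt_one_plus_square_neq0 [simp]: "sqrt (1 + (w::real)\<^sup>2) \<noteq> 0"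
  using sqrt_one_plus_square_pos[of w] by linarith

lemma abs_psi_less_one: "\<bar>psi w\<bar> < 1"
proof -
  have "\<bar>w\<bar> = sqrt (w\<^sup>2)" by simp
  also have "\<dots> < sqrt (1 + w\<^sup>2)" by (rule real_sqrt_less_mono) simp
  finally show ?thesis by (simp add: psi_def abs_divide)
qed

lemma phi_psi: "phi (psi w) = w"
proof -
  have "1 - (psi w)\<^sup>2 = 1 / (1 + w\<^sup>2)"
    by (simp add: psi_def power_divide divide_simps)
  then show ?thesis
    by (simp add: phi_def real_sqrt_divide) (simp add: psi_def)
qed

lemma psi_0 [simp]: "psi 0 = 0" by (simp add: psi_def)

lemma psi_minus [simp]: "psi (- w) = - psi w" by (simp add: psi_def)

lemma psi_pos_iff [simp]: "0 < psi w \<longleftrightarrow> 0 < w"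
  by (simp add: psi_def zero_less_divide_iff)

text \<open>This is what makes \<open>sqrt (1 + w\<^sup>2)\<close> the kinetic energy: its
  derivative is the velocity \<open>psi w\<close>, so in the energy balance the work terms combine
  with those of \<open>G\<close>.\<close>

lemma DERIV_sqrt_one_plus_square: "((\<lambda>w. sqrt (1 + w\<^sup>2)) has_real_derivative psi w) (at w)"
  by (auto intro!: derivative_eq_intros simp: psi_def divide_simps)

lemma DERIV_psi: "(psi has_real_derivative 1 / (sqrt (1 + w\<^sup>2)) ^ 3) (at w)"
proof -
  have "sqrt (1 + w\<^sup>2) * sqrt (1 + w\<^sup>2) = 1 + w\<^sup>2" by simp
  then have "1 / sqrt (1 + w\<^sup>2) ^ 3
      = (1 * sqrt (1 + w\<^sup>2) - w * psi w) / (sqrt (1 + w\<^sup>2) * sqrt (1 + w\<^sup>2))"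
    by (simp add: psi_def divide_simps power3_eq_cube power2_eq_square)
  then show ?thesis
    unfolding psi_def[abs_def]
    by (auto intro!: derivative_eq_intros DERIV_sqrt_one_plus_square[THEN DERIV_cong] simp: psi_def)
qed

lemma psi_strict_mono: "x < y \<Longrightarrow> psi x < psi y"
  by (rule DERIV_pos_imp_increasing) (auto intro!: exI DERIV_psi)

lemma psi_mono: "x \<le> y \<Longrightarrow> psi x \<le> psi y"
  using psi_strict_mono[of x y] by (cases "x = y") auto

lemma psi_lipschitz: "\<bar>psi x - psi y\<bar> \<le> \<bar>x - y\<bar>"
proof -
  have "\<bar>1 / (sqrt (1 + w\<^sup>2)) ^ 3\<bar> \<le> 1" for w :: real
    by (simp add: abs_divide)
  then have "norm (psi x - psi y) \<le> 1 * norm (x - y)"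
    by (intro field_differentiable_bound[of UNIV psi]) (auto intro: DERIV_psi)
  then show ?thesis by simp
qed

lemma continuous_on_psi [continuous_intros]: "continuous_on S h \<Longrightarrow> continuous_on S (\<lambda>x. psi (h x))"
  unfolding psi_def
  by (intro continuous_intros) auto

text \<open>Convexity in the form of a tangent inequality; it reduces to the Cauchy-Schwarz
  inequality for the vectors \<open>(1, x)\<close> and \<open>(1, y)\<close>.\<close>

lemma sqrt_one_plus_square_tangent: "sqrt (1 + x\<^sup>2) + psi x * (y - x) \<le> sqrt (1 + y\<^sup>2)"
proof -
  have "(1 + x * y)\<^sup>2 \<le> (1 + x\<^sup>2) * (1 + y\<^sup>2)"
    using zero_le_power2[of "x - y"] by (simp add: power2_eq_square algebra_simps)
  then have "1 + x * y \<le> sqrt ((1 + x\<^sup>2) * (1 + y\<^sup>2))"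
    by (rule real_le_rsqrt)
  also have "\<dots> = sqrt (1 + x\<^sup>2) * sqrt (1 + y\<^sup>2)" by (rule real_sqrt_mult)
  finally have *: "1 + x * y \<le> sqrt (1 + x\<^sup>2) * sqrt (1 + y\<^sup>2)" .
  have "sqrt (1 + x\<^sup>2) * sqrt (1 + x\<^sup>2) = 1 + x\<^sup>2" by simp
  then have "sqrt (1 + x\<^sup>2) + psi x * (y - x) = (1 + x * y) / sqrt (1 + x\<^sup>2)"
    by (simp add: psi_def divide_simps power2_eq_square algebra_simps)
  also have "\<dots> \<le> sqrt (1 + y\<^sup>2)"
    using * by (simp add: divide_le_eq mult.commute)
  finally show ?thesis .
qed

section \<open>Integral formulation of the first-order system\<close>

lemma has_integral_abs_le:
  fixes h k :: "real \<Rightarrow> real"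
  assumes "(h has_integral i) S" "(k has_integral j) S" "\<And>r. r \<in> S \<Longrightarrow> \<bar>h r\<bar> \<le> k r"
  shows "\<bar>i\<bar> \<le> j"
proof -
  have "norm (integral S h) \<le> integral S k"
    using assms by (intro integral_norm_bound_integral) auto
  then show ?thesis using assms(1,2) by (simp add: integral_unique)
qed

lemma has_integral_abs_le_const:
  fixes h :: "real \<Rightarrow> real"
  assumes "(h has_integral i) {s..t}" "\<And>r. r \<in> {s..t} \<Longrightarrow> \<bar>h r\<bar> \<le> C" "s \<le> t"
  shows "\<bar>i\<bar> \<le> C * (t - s)"
  using has_integral_abs_le[OF assms(1) has_integral_const_real[of C s t] assms(2)] assms(3)
  by (simp add: mult.commute)

text \<open>The system is stated in integrated form because \<open>Q\<close> is merely measurable in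
  the application, so that \<open>W\<close> is differentiable only almost everywhere. The second
  increment is \<open>W s - W t\<close> to absorb the minus sign of the equation.\<close>

definition trajectory :: "(real \<Rightarrow> real) \<Rightarrow> (real \<Rightarrow> real) \<Rightarrow> real \<Rightarrow> (real \<Rightarrow> real) \<Rightarrow> (real \<Rightarrow> real) \<Rightarrow> bool" where
  "trajectory Q g t0 V W \<longleftrightarrow>
     continuous_on {t0..} V \<and> continuous_on {t0..} W \<and>
     (\<forall>s t. t0 \<le> s \<longrightarrow> s \<le> t \<longrightarrow>
        ((\<lambda>r. psi (W r)) has_integral V t - V s) {s..t} \<and>
        ((\<lambda>r. Q r * g (V r)) has_integral W s - W t) {s..t})"

locale lipschitz_system =
  fixes Q g :: "real \<Rightarrow> real" and t0 M L B :: real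
  assumes Q_measurable: "Q \<in> borel_measurable (lebesgue_on {t0..})"
    and Q_bound: "\<And>t. t0 \<le> t \<Longrightarrow> \<bar>Q t\<bar> \<le> M"
    and g_lipschitz: "\<And>x y. \<bar>g x - g y\<bar> \<le> L * \<bar>x - y\<bar>"
    and g_bound: "\<And>x. \<bar>g x\<bar> \<le> B"
begin

lemma M_nonneg: "0 \<le> M" using Q_bound[of t0] by linarith
lemma B_nonneg: "0 \<le> B" using g_bound[of 0] by linarith
lemma L_nonneg: "0 \<le> L" using g_lipschitz[of 0 1] by simp

lemma g_continuous: "continuous_on S g"
proof -
  have "L-lipschitz_on S g"
    by (rule lipschitz_onI) (auto simp: dist_real_def L_nonneg intro: g_lipschitz)
  then show ?thesis by (rule lipschitz_on_continuous_on)
qed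

lemma Qg_bound: "t0 \<le> t \<Longrightarrow> \<bar>Q t * g x\<bar> \<le> M * B"
  using Q_bound[of t] g_bound[of x] by (simp add: abs_mult mult_mono M_nonneg)

lemma Qg_integrable:
  assumes V: "continuous_on {t0..} V" and "t0 \<le> s"
  shows "(\<lambda>r. Q r * g (V r)) integrable_on {s..t}"
proof (rule measurable_bounded_by_integrable_imp_integrable)
  have sub: "{s..t} \<subseteq> {t0..}" using \<open>t0 \<le> s\<close> by auto
  have "Q \<in> borel_measurable (lebesgue_on {s..t})"
    using measurable_restrict_mono[OF Q_measurable sub] .
  moreover have "continuous_on {s..t} (\<lambda>r. g (V r))"
    using continuous_on_compose2[OF g_continuous[of UNIV] continuous_on_subset[OF V sub]] by auto
  then have "(\<lambda>r. g (V r)) \<in> borel_measurable (lebesgue_on {s..t})"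
    by (rule continuous_imp_measurable_on_sets_lebesgue) auto
  ultimately show "(\<lambda>r. Q r * g (V r)) \<in> borel_measurable (lebesgue_on {s..t})"
    by measurable
  show "(\<lambda>r. M * B) integrable_on {s..t}" by (rule integrable_const_ivl)
  show "norm (Q r * g (V r)) \<le> M * B" if "r \<in> {s..t}" for r
    using Qg_bound[of r] that \<open>t0 \<le> s\<close> by auto
qed auto

end

section \<open>Global existence by a weighted Picard iteration\<close>

lemma has_integral_exp_weight:
  fixes K :: real
  assumes "0 < K" "t0 \<le> t"
  shows "((\<lambda>r. C * exp (K * (r - t0))) has_integral C * (exp (K * (t - t0)) - 1) / K) {t0..t}"
proof -
  have "((\<lambda>r. C * exp (K * (r - t0))) has_integral
      C * exp (K * (t - t0)) / K - C * exp (K * (t0 - t0)) / K) {t0..t}"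
    using assms
    by (intro fundamental_theorem_of_calculus)
       (auto intro!: derivative_eq_intros simp flip: has_real_derivative_iff_has_vector_derivative)
  then show ?thesis by (simp add: diff_divide_distrib right_diff_distrib)
qed

context lipschitz_system
begin

definition position :: "real \<Rightarrow> (real \<Rightarrow> real) \<Rightarrow> real \<Rightarrow> real" where
  "position a W t = a + integral {t0..t} (\<lambda>r. psi (W r))"

lemma position_has_integral:
  assumes W: "continuous_on {t0..} W" and "t0 \<le> s" "s \<le> t"
  shows "((\<lambda>r. psi (W r)) has_integral position a W t - position a W s) {s..t}"
proof -
  have int: "(\<lambda>r. psi (W r)) integrable_on {u..t}" if "t0 \<le> u" for u
    using that by (intro integrable_continuous_interval continuous_intros continuous_on_subset[OF W]) auto
  have "integral {t0..s} (\<lambda>r. psi (W r)) + integral {s..t} (\<lambda>r. psi (W r)) = integral {t0..t} (\<lambda>r. psi (W r))"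
    using assms int by (intro Henstock_Kurzweil_Integration.integral_combine) auto
  then have "position a W t - position a W s = integral {s..t} (\<lambda>r. psi (W r))"
    by (simp add: position_def)
  then show ?thesis
    using integrable_integral[OF int[OF \<open>t0 \<le> s\<close>]] by simp
qed

lemma position_continuous:
  assumes W: "continuous_on {t0..} W"
  shows "continuous_on {t0..} (position a W)"
proof (rule lipschitz_on_continuous_on, rule lipschitz_onI)
  have *: "\<bar>position a W t - position a W s\<bar> \<le> \<bar>t - s\<bar>" if st: "t0 \<le> s" "s \<le> t" for s t
  proof -
    have "\<bar>position a W t - position a W s\<bar> \<le> 1 * (t - s)"
      using st abs_psi_less_one
      by (intro has_integral_abs_le_const[OF position_has_integral[OF W st]]) (auto intro: less_imp_le)
    then show ?thesis using st by simp
  qed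
  show "dist (position a W s) (position a W t) \<le> 1 * dist s t" if "s \<in> {t0..}" "t \<in> {t0..}" for s t
    using *[of s t] *[of t s] that by (cases "s \<le> t") (auto simp: dist_real_def)
qed simp

text \<open>\<open>psi\<close> is 1-Lipschitz, and integrating the weight
  \<open>exp (K * (r - t0))\<close> gains a factor \<open>1 / K\<close>.\<close>

lemma position_diff_le:
  assumes W: "continuous_on {t0..} W" and W': "continuous_on {t0..} W'" and K: "0 < K"
    and le: "\<And>r. t0 \<le> r \<Longrightarrow> \<bar>W r - W' r\<bar> \<le> C * exp (K * (r - t0))"
    and t: "t0 \<le> t" and C: "0 \<le> C"
  shows "\<bar>position a W t - position a W' t\<bar> \<le> C / K * exp (K * (t - t0))"
proof -
  have "((\<lambda>r. psi (W r) - psi (W' r)) has_integral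
      (position a W t - position a W t0) - (position a W' t - position a W' t0)) {t0..t}"
    using t by (intro has_integral_diff position_has_integral W W') auto
  then have "((\<lambda>r. psi (W r) - psi (W' r)) has_integral position a W t - position a W' t) {t0..t}"
    by (simp add: position_def)
  then have "\<bar>position a W t - position a W' t\<bar> \<le> C * (exp (K * (t - t0)) - 1) / K"
    by (rule has_integral_abs_le[OF _ has_integral_exp_weight[OF K t]])
       (use le psi_lipschitz order_trans in fastforce)
  also have "\<dots> \<le> C / K * exp (K * (t - t0))"
    using K C by (simp add: field_simps)
  finally show ?thesis by simp
qed

text \<open>The position is eliminated, so the iteration runs on the momentum \<open>W\<close>
  alone; a fixed point together with its \<open>position\<close> is a trajectory.\<close>

definition picard :: "real \<Rightarrow> real \<Rightarrow> (real \<Rightarrow> real) \<Rightarrow> real \<Rightarrow> real" where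
  "picard a b W t = b - integral {t0..t} (\<lambda>r. Q r * g (position a W r))"

lemma picard_has_integral:
  assumes W: "continuous_on {t0..} W" and "t0 \<le> s" "s \<le> t"
  shows "((\<lambda>r. Q r * g (position a W r)) has_integral picard a b W s - picard a b W t) {s..t}"
proof -
  note int = Qg_integrable[OF position_continuous[OF W, of a]]
  have "integral {t0..s} (\<lambda>r. Q r * g (position a W r)) + integral {s..t} (\<lambda>r. Q r * g (position a W r))
      = integral {t0..t} (\<lambda>r. Q r * g (position a W r))"
    using assms int by (intro Henstock_Kurzweil_Integration.integral_combine) auto
  then have "picard a b W s - picard a b W t = integral {s..t} (\<lambda>r. Q r * g (position a W r))"
    by (simp add: picard_def)
  then show ?thesis
    using integrable_integral[OF int[OF \<open>t0 \<le> s\<close>]] by simp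
qed

lemma picard_lipschitz:
  assumes W: "continuous_on {t0..} W" and st: "t0 \<le> s" "t0 \<le> t"
  shows "\<bar>picard a b W t - picard a b W s\<bar> \<le> M * B * \<bar>t - s\<bar>"
proof -
  have *: "\<bar>picard a b W t - picard a b W s\<bar> \<le> M * B * \<bar>t - s\<bar>" if st: "t0 \<le> s" "s \<le> t" for s t
  proof -
    have "\<bar>picard a b W s - picard a b W t\<bar> \<le> M * B * (t - s)"
      using Qg_bound st by (intro has_integral_abs_le_const[OF picard_has_integral[OF W st]]) auto
    then show ?thesis using st by (simp add: abs_minus_commute)
  qed
  show ?thesis using *[of s t] *[of t s] st by (cases "s \<le> t") (auto simp: abs_minus_commute)
qed

text \<open>A second integration of the weight gains another factor \<open>1 / K\<close>; the
  resulting constant \<open>M * L / K\<^sup>2\<close> is small for large \<open>K\<close>, which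
  gives the contraction.\<close>

lemma picard_diff_le:
  assumes W: "continuous_on {t0..} W" and W': "continuous_on {t0..} W'" and K: "0 < K"
    and le: "\<And>r. t0 \<le> r \<Longrightarrow> \<bar>W r - W' r\<bar> \<le> C * exp (K * (r - t0))"
    and t: "t0 \<le> t" and C: "0 \<le> C"
  shows "\<bar>picard a b W t - picard a b W' t\<bar> \<le> M * L * C / K\<^sup>2 * exp (K * (t - t0))"
proof -
  let ?D = "M * L * C / K"
  have "((\<lambda>r. Q r * g (position a W r) - Q r * g (position a W' r)) has_integral
      (picard a b W t0 - picard a b W t) - (picard a b W' t0 - picard a b W' t)) {t0..t}"
    using t by (intro has_integral_diff picard_has_integral W W') auto
  then have "((\<lambda>r. Q r * g (position a W r) - Q r * g (position a W' r)) has_integral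
      picard a b W' t - picard a b W t) {t0..t}"
    by (simp add: picard_def)
  then have "\<bar>picard a b W' t - picard a b W t\<bar> \<le> ?D * (exp (K * (t - t0)) - 1) / K"
  proof (rule has_integral_abs_le[OF _ has_integral_exp_weight[OF K t]])
    fix r assume r: "r \<in> {t0..t}"
    have "\<bar>Q r * g (position a W r) - Q r * g (position a W' r)\<bar>
        = \<bar>Q r\<bar> * \<bar>g (position a W r) - g (position a W' r)\<bar>"
      by (simp add: abs_mult flip: right_diff_distrib)
    also have "\<dots> \<le> M * (L * (C / K * exp (K * (r - t0))))"
      using r Q_bound[of r] g_lipschitz[of "position a W r" "position a W' r"]
        mult_left_mono[OF position_diff_le[OF W W' K le _ C, of r] L_nonneg] M_nonneg
      by (intro mult_mono) (auto intro: order_trans)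
    finally show "\<bar>Q r * g (position a W r) - Q r * g (position a W' r)\<bar> \<le> ?D * exp (K * (r - t0))"
      by simp
  qed
  also have "\<dots> \<le> ?D * exp (K * (t - t0)) / K"
    using K C M_nonneg L_nonneg by (intro divide_right_mono mult_left_mono) auto
  finally show ?thesis by (simp add: power2_eq_square abs_minus_commute)
qed

text \<open>Bielecki's weight \<open>exp (- K (t - t0))\<close> makes the Picard operator a contraction on the whole
  half-line at once, so that no continuation of local solutions is needed.\<close>

lemma trajectory_exists:
  obtains V W where "trajectory Q g t0 V W" "V t0 = a" "W t0 = b"
proof -
  \<comment> \<open>This choice gives \<open>2 * M * L \<le> K \<le> K\<^sup>2\<close>, hence the
    contraction constant 1/2.\<close>
  define K where "K = 1 + 2 * M * L"
  have K1: "1 \<le> K" using M_nonneg L_nonneg by (simp add: K_def)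
  then have K0: "0 < K" by simp
  have c: "M * L / K\<^sup>2 \<le> 1 / 2"
  proof -
    have "2 * M * L \<le> K * 1" by (simp add: K_def)
    also have "\<dots> \<le> K * K" using K1 by (intro mult_left_mono) auto
    finally show ?thesis using K0 by (simp add: field_simps power2_eq_square)
  qed
  define unw where "unw u t = exp (K * (t - t0)) * apply_bcontfun u t" for u :: "real \<Rightarrow>\<^sub>C real" and t
  \<comment> \<open>The fixed-point space consists of bounded continuous functions on the whole
    line; \<open>max t0 t\<close> extends the weighted iterate to the left of \<open>t0\<close> by
    its value at \<open>t0\<close>.\<close>
  define T where "T u t = exp (- K * (max t0 t - t0)) * picard a b (unw u) (max t0 t)"
    for u :: "real \<Rightarrow>\<^sub>C real" and t
  have unw_cont: "continuous_on S (unw u)" for S and u :: "real \<Rightarrow>\<^sub>C real"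
    unfolding unw_def by (intro continuous_intros) auto
  have bc: "T u \<in> bcontfun" for u :: "real \<Rightarrow>\<^sub>C real"
  proof (rule bcontfun_normI)
    have pl: "(M * B)-lipschitz_on {t0..} (picard a b (unw u))"
      by (rule lipschitz_onI)
         (use picard_lipschitz[OF unw_cont] M_nonneg B_nonneg in \<open>auto simp: dist_real_def\<close>)
    have "continuous_on UNIV (\<lambda>t. picard a b (unw u) (max t0 t))"
      by (rule continuous_on_compose2[OF lipschitz_on_continuous_on[OF pl]])
         (auto intro!: continuous_intros)
    then show "continuous_on UNIV (T u)"
      unfolding T_def by (intro continuous_intros) auto
    show "norm (T u t) \<le> \<bar>b\<bar> + M * B" for t
    proof -
      define s where "s = max t0 t"
      have s: "t0 \<le> s" by (simp add: s_def)
      \<comment> \<open>The Picard iterate grows at most linearly, since the forcing is bounded by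
        \<open>M * B\<close>. The exponential weight dominates this growth because
        \<open>K \<ge> 1\<close>.\<close>
      have e: "1 + K * (s - t0) \<le> exp (K * (s - t0))" by (rule exp_ge_add_one_self)
      have "s - t0 \<le> K * (s - t0)" using K1 s mult_right_mono[of 1 K "s - t0"] by simp
      then have e1: "s - t0 \<le> exp (K * (s - t0))" using e by linarith
      have e2: "1 \<le> exp (K * (s - t0))" using K0 s by simp
      have "\<bar>picard a b (unw u) s\<bar> \<le> \<bar>b\<bar> + M * B * (s - t0)"
        using picard_lipschitz[OF unw_cont, of t0 s a b u] s by (auto simp: picard_def)
      also have "\<dots> \<le> \<bar>b\<bar> * exp (K * (s - t0)) + M * B * exp (K * (s - t0))"
        using mult_left_mono[OF e1, of "M * B"] mult_left_mono[OF e2, of "\<bar>b\<bar>"] M_nonneg B_nonneg by simp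
      finally have "\<bar>picard a b (unw u) s\<bar> \<le> (\<bar>b\<bar> + M * B) * exp (K * (s - t0))"
        by (simp add: distrib_right)
      then have "exp (- (K * (s - t0))) * \<bar>picard a b (unw u) s\<bar> \<le> \<bar>b\<bar> + M * B"
        by (simp add: exp_minus divide_simps mult.commute)
      then show ?thesis
        by (simp add: T_def abs_mult s_def)
    qed
  qed
  define P where "P u = Bcontfun (T u)" for u
  have P: "apply_bcontfun (P u) = T u" for u
    using bc by (simp add: P_def Bcontfun_inverse)
  have "\<exists>!u. P u = u"
  proof (rule banach_fix_type[of "1/2"])
    show "\<forall>u u'. dist (P u) (P u') \<le> 1 / 2 * dist u u'"
    proof (intro allI dist_bound)
      fix u u' :: "real \<Rightarrow>\<^sub>C real" and t
      let ?C = "dist u u'"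
      define s where "s = max t0 t"
      have s: "t0 \<le> s" by (simp add: s_def)
      have "\<bar>unw u r - unw u' r\<bar> \<le> ?C * exp (K * (r - t0))" for r
        using mult_right_mono[OF dist_bounded[of u r u'], of "exp (K * (r - t0))"]
        by (simp add: unw_def abs_mult dist_real_def mult.commute[of "exp _"] flip: left_diff_distrib)
      then have "\<bar>picard a b (unw u) s - picard a b (unw u') s\<bar> \<le> M * L * ?C / K\<^sup>2 * exp (K * (s - t0))"
        using s by (intro picard_diff_le unw_cont K0) auto
      also have "\<dots> = ?C * exp (K * (s - t0)) * (M * L / K\<^sup>2)" by simp
      also have "\<dots> \<le> ?C * exp (K * (s - t0)) * (1 / 2)" using c by (intro mult_left_mono) auto
      finally have "exp (- (K * (s - t0))) * \<bar>picard a b (unw u) s - picard a b (unw u') s\<bar> \<le> 1 / 2 * ?C"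
        by (simp add: exp_minus divide_simps mult.commute)
      then show "dist (apply_bcontfun (P u) t) (apply_bcontfun (P u') t) \<le> 1 / 2 * ?C"
        by (simp add: P T_def dist_real_def abs_mult s_def flip: right_diff_distrib)
    qed
  qed auto
  then obtain u where "P u = u" by blast
  then have Tu: "apply_bcontfun u t = T u t" for t using P[of u] by simp
  let ?W = "unw u" and ?V = "position a (unw u)"
  have fix_eq: "?W t = picard a b ?W t" if "t0 \<le> t" for t
    using that Tu[of t] unfolding T_def unw_def
    by (simp add: exp_minus max_absorb2)
  show thesis
  proof
    show "trajectory Q g t0 ?V ?W"
      unfolding trajectory_def
      using position_has_integral[OF unw_cont] picard_has_integral[OF unw_cont] fix_eq
      by (auto simp: unw_cont intro!: position_continuous)
    show "?V t0 = a" by (simp add: position_def)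
    show "?W t0 = b" using fix_eq[of t0] by (simp add: picard_def)
  qed
qed

end

section \<open>Gronwall inequalities and differentiation of integrals\<close>

lemma gronwall_forward:
  fixes S :: "real \<Rightarrow> real"
  assumes cont: "continuous_on {s..t} S" and "s \<le> t" and "0 \<le> K"
    and le: "\<And>r. r \<in> {s..t} \<Longrightarrow> S r \<le> A + K * integral {s..r} S"
  shows "S t \<le> A * exp (K * (t - s))"
proof -
  \<comment> \<open>The right-hand side of the hypothesis times an integrating factor; by that
    hypothesis its derivative is nonpositive.\<close>
  let ?h = "\<lambda>r. exp (- (K * (r - s))) * (A + K * integral {s..r} S)"
  have "?h t \<le> ?h s"
  proof (rule DERIV_nonpos_imp_decreasing_open[OF \<open>s \<le> t\<close>])
    fix r assume r: "s < r" "r < t"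
    then have "((\<lambda>r. integral {s..r} S) has_real_derivative S r) (at r)"
      using integral_has_real_derivative[OF cont, of r] at_within_Icc_at[of s r t] by simp
    then have "(?h has_real_derivative exp (- (K * (r - s))) * (K * (S r - (A + K * integral {s..r} S)))) (at r)"
      by (auto intro!: derivative_eq_intros simp: algebra_simps)
    moreover have "exp (- (K * (r - s))) * (K * (S r - (A + K * integral {s..r} S))) \<le> 0"
      using le[of r] r \<open>0 \<le> K\<close> by (intro mult_nonneg_nonpos) auto
    ultimately show "\<exists>y. (?h has_real_derivative y) (at r) \<and> y \<le> 0" by blast
  next
    show "continuous_on {s..t} ?h"
      by (intro continuous_intros indefinite_integral_continuous_1 integrable_continuous_interval cont)
  qed
  then have "A + K * integral {s..t} S \<le> A * exp (K * (t - s))"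
    by (simp add: exp_minus divide_simps mult.commute)
  then show ?thesis using le[of t] \<open>s \<le> t\<close> by auto
qed

text \<open>The version with the integral anchored at the right endpoint bounds the past by the
  future, which yields uniqueness backward in time.\<close>

lemma gronwall_backward:
  fixes S :: "real \<Rightarrow> real"
  assumes cont: "continuous_on {s..t} S" and "s \<le> t" and "0 \<le> K"
    and le: "\<And>r. r \<in> {s..t} \<Longrightarrow> S r \<le> A + K * integral {r..t} S"
  shows "S s \<le> A * exp (K * (t - s))"
proof -
  let ?h = "\<lambda>r. exp (- (K * (t - r))) * (A + K * integral {r..t} S)"
  have "?h s \<le> ?h t"
  proof (rule DERIV_nonneg_imp_increasing_open[OF \<open>s \<le> t\<close>])
    fix r assume r: "s < r" "r < t"
    then have "((\<lambda>r. integral {r..t} S) has_real_derivative - S r) (at r)"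
      using integral_has_real_derivative'[OF cont, of r] at_within_Icc_at[of s r t] by simp
    then have "(?h has_real_derivative exp (- (K * (t - r))) * (K * ((A + K * integral {r..t} S) - S r))) (at r)"
      by (auto intro!: derivative_eq_intros simp: algebra_simps)
    moreover have "0 \<le> exp (- (K * (t - r))) * (K * ((A + K * integral {r..t} S) - S r))"
      using le[of r] r \<open>0 \<le> K\<close> by (intro mult_nonneg_nonneg) auto
    ultimately show "\<exists>y. (?h has_real_derivative y) (at r) \<and> 0 \<le> y" by blast
  next
    show "continuous_on {s..t} ?h"
      by (intro continuous_intros indefinite_integral_continuous_1' integrable_continuous_interval cont)
  qed
  then have "A + K * integral {s..t} S \<le> A * exp (K * (t - s))"
    by (simp add: exp_minus divide_simps mult.commute)
  then show ?thesis using le[of s] \<open>s \<le> t\<close> by auto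
qed

lemma has_derivative_within_of_has_integral:
  fixes h H :: "real \<Rightarrow> real"
  assumes cont: "continuous_on {t0..} h"
    and int: "\<And>t. t0 \<le> t \<Longrightarrow> (h has_integral H t - H t0) {t0..t}" and "t0 \<le> t"
  shows "(H has_real_derivative h t) (at t within {t0..})"
proof -
  have "((\<lambda>r. H t0 + integral {t0..r} h) has_real_derivative h t) (at t within {t0..t + 1})"
    using \<open>t0 \<le> t\<close> continuous_on_subset[OF cont]
    by (auto intro!: derivative_eq_intros integral_has_real_derivative[of t0 "t + 1" h])
  \<comment> \<open>The bounded interval serves only to apply the fundamental theorem; near
    \<open>t\<close> it coincides with the half-line, so the endpoint \<open>t0\<close> is covered
    with a one-sided derivative.\<close>
  moreover have "at t within {t0..t + 1} = at t within {t0..}"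
    by (rule at_within_nhd[of t "{..<t + 1}"]) auto
  ultimately have "((\<lambda>r. H t0 + integral {t0..r} h) has_real_derivative h t) (at t within {t0..})"
    by simp
  then show ?thesis
    by (rule has_field_derivative_transform_within[where d=1])
       (use int[THEN integral_unique] \<open>t0 \<le> t\<close> in auto)
qed

text \<open>The theorem \<open>integrable_ccontinuous_explicit\<close> only controls averages over intervals to the right
  of a point; applying it to the reflected function as well gives the two-sided statement.\<close>

lemma lebesgue_differentiation:
  fixes h :: "real \<Rightarrow> real"
  assumes int: "\<And>a b. h integrable_on {a..b}"
  obtains N where "negligible N"
    "\<And>x a. x \<notin> N \<Longrightarrow> a < x \<Longrightarrow> ((\<lambda>t. integral {a..t} h) has_real_derivative h x) (at x)"
proof -
  obtain N1 where N1: "negligible N1"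
    "\<And>x e. x \<notin> N1 \<Longrightarrow> 0 < e \<Longrightarrow> \<exists>d>0. \<forall>k. 0 < k \<and> k < d \<longrightarrow> \<bar>integral {x..x + k} h / k - h x\<bar> < e"
    using integrable_ccontinuous_explicit[of h] int by (auto simp: divide_inverse mult.commute)
  have int': "(\<lambda>x. h (- x)) integrable_on {a..b}" for a b
    using int[of "- b" "- a"] Henstock_Kurzweil_Integration.integrable_reflect_real[where f = h and a = "- b" and b = "- a"] by simp
  obtain N2 where N2: "negligible N2"
    "\<And>x e. x \<notin> N2 \<Longrightarrow> 0 < e \<Longrightarrow>
       \<exists>d>0. \<forall>k. 0 < k \<and> k < d \<longrightarrow> \<bar>integral {x..x + k} (\<lambda>x. h (- x)) / k - h (- x)\<bar> < e"
    using integrable_ccontinuous_explicit[of "\<lambda>x. h (- x)"] int' by (auto simp: divide_inverse mult.commute)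
  show thesis
  proof
    show "negligible (N1 \<union> uminus ` N2)"
      using N1(1) N2(1)
      by (intro negligible_Un negligible_differentiable_image_negligible) (auto intro!: derivative_intros)
    fix x a assume x: "x \<notin> N1 \<union> uminus ` N2" and "a < x"
    then have x1: "x \<notin> N1" and x2: "- x \<notin> N2" by (auto simp: image_iff)
    have "\<exists>d>0. \<forall>k. k \<noteq> 0 \<and> \<bar>k\<bar> < d \<longrightarrow>
        \<bar>(integral {a..x + k} h - integral {a..x} h) / k - h x\<bar> < e" if e: "0 < e" for e
    proof -
      obtain d1 where d1: "d1 > 0" "\<And>k. 0 < k \<Longrightarrow> k < d1 \<Longrightarrow> \<bar>integral {x..x + k} h / k - h x\<bar> < e"
        using N1(2)[OF x1 e] by blast
      obtain d2 where d2: "d2 > 0" "\<And>k. 0 < k \<Longrightarrow> k < d2 \<Longrightarrow>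
          \<bar>integral {- x..- x + k} (\<lambda>x. h (- x)) / k - h x\<bar> < e"
        using N2(2)[OF x2 e] by auto
      let ?d = "min (min d1 d2) (x - a)"
      have "\<bar>(integral {a..x + k} h - integral {a..x} h) / k - h x\<bar> < e" if k: "k \<noteq> 0" "\<bar>k\<bar> < ?d" for k
      proof (cases "0 < k")
        case True
        have "integral {a..x} h + integral {x..x + k} h = integral {a..x + k} h"
          using \<open>a < x\<close> True by (intro Henstock_Kurzweil_Integration.integral_combine int) auto
        then have "integral {a..x + k} h - integral {a..x} h = integral {x..x + k} h" by simp
        then show ?thesis using d1(2)[of k] k True by simp
      next
        case False
        have "integral {a..x + k} h + integral {x + k..x} h = integral {a..x} h"
          using k False by (intro Henstock_Kurzweil_Integration.integral_combine int) auto
        moreover have "integral {- x..- x + - k} (\<lambda>x. h (- x)) = integral {x + k..x} h"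
          using Henstock_Kurzweil_Integration.integral_reflect_real[where f = h and a = "x + k" and b = x] by (simp add: algebra_simps)
        ultimately have "integral {a..x + k} h - integral {a..x} h = - integral {- x..- x + - k} (\<lambda>x. h (- x))"
          by simp
        then show ?thesis using d2(2)[of "- k"] k False by simp
      qed
      moreover have "0 < ?d" using d1 d2 \<open>a < x\<close> by simp
      ultimately show ?thesis by blast
    qed
    then show "((\<lambda>t. integral {a..t} h) has_real_derivative h x) (at x)"
      unfolding DERIV_def LIM_def by (simp add: dist_real_def)
  qed
qed

section \<open>Regularity of trajectories and continuous dependence on the data\<close>

context lipschitz_system
begin

context
  fixes V W
  assumes traj: "trajectory Q g t0 V W"
begin

lemma V_cont: "continuous_on {t0..} V" and W_cont: "continuous_on {t0..} W"
  using traj by (auto simp: trajectory_def)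

lemma V_int: "t0 \<le> s \<Longrightarrow> s \<le> t \<Longrightarrow> ((\<lambda>r. psi (W r)) has_integral V t - V s) {s..t}"
  and W_int: "t0 \<le> s \<Longrightarrow> s \<le> t \<Longrightarrow> ((\<lambda>r. Q r * g (V r)) has_integral W s - W t) {s..t}"
  using traj by (auto simp: trajectory_def)

lemma V_deriv: "t0 \<le> t \<Longrightarrow> (V has_real_derivative psi (W t)) (at t within {t0..})"
  using V_int by (intro has_derivative_within_of_has_integral continuous_intros W_cont) auto

lemma W_lipschitz: "t0 \<le> s \<Longrightarrow> s \<le> t \<Longrightarrow> \<bar>W t - W s\<bar> \<le> M * B * (t - s)"
  using has_integral_abs_le_const[OF W_int Qg_bound] by (simp add: abs_minus_commute)

lemma W_deriv:
  assumes "continuous_on {t0..} Q" "t0 \<le> t"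
  shows "(W has_real_derivative - (Q t * g (V t))) (at t within {t0..})"
proof -
  have "((\<lambda>t. - W t) has_real_derivative Q t * g (V t)) (at t within {t0..})"
  proof (rule has_derivative_within_of_has_integral)
    show "continuous_on {t0..} (\<lambda>r. Q r * g (V r))"
      using continuous_on_compose2[OF g_continuous[of UNIV] V_cont] assms
      by (intro continuous_intros) auto
  qed (use W_int assms in auto)
  then show ?thesis using DERIV_minus by fastforce
qed

lemma W_deriv_AE:
  "AE t in lebesgue. t0 < t \<longrightarrow> (W has_real_derivative - (Q t * g (V t))) (at t)"
proof -
  \<comment> \<open>Extension by zero makes the integrand integrable on every compact interval, as
    the differentiation result requires; for \<open>t > t0\<close> the derivative is
    unaffected.\<close>
  define h where "h r = (if r \<in> {t0..} then Q r * g (V r) else 0)" for r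
  have hint: "h integrable_on {a..b}" for a b
  proof -
    have "(\<lambda>r. Q r * g (V r)) integrable_on {max a t0..b}"
      by (intro Qg_integrable V_cont) simp
    moreover have "{max a t0..b} = {t0..} \<inter> {a..b}" by auto
    ultimately show ?thesis unfolding h_def integrable_restrict_Int by simp
  qed
  obtain N where N: "negligible N"
    "\<And>x a. x \<notin> N \<Longrightarrow> a < x \<Longrightarrow> ((\<lambda>t. integral {a..t} h) has_real_derivative h x) (at x)"
    using lebesgue_differentiation[OF hint] by blast
  have "(W has_real_derivative - (Q t * g (V t))) (at t)" if "t \<notin> N" "t0 < t" for t
  proof -
    have "((\<lambda>t. W t0 - integral {t0..t} h) has_real_derivative - h t) (at t)"
      using N(2)[OF that] by (auto intro!: derivative_eq_intros)
    then have "(W has_real_derivative - h t) (at t)"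
    proof (rule has_field_derivative_transform_within_open[of _ _ _ "{t0<..}"])
      fix x assume "x \<in> {t0<..}"
      then have "(h has_integral W t0 - W x) {t0..x}"
        using W_int[of t0 x] by (subst has_integral_cong[of _ _ "\<lambda>r. Q r * g (V r)"]) (auto simp: h_def)
      then show "W t0 - integral {t0..x} h = W x" by (simp add: integral_unique)
    qed (use that in auto)
    then show ?thesis using that by (simp add: h_def)
  qed
  moreover have "N \<in> null_sets lebesgue" using N(1) by (simp add: negligible_iff_null_sets)
  ultimately show ?thesis by (intro AE_I'[of N]) auto
qed

end

text \<open>The constant adds the Lipschitz constants 1 of \<open>psi\<close> and
  \<open>M * L\<close> of the force. The forward bound gives continuity of the shooting map; the
  backward bound shows that an equilibrium cannot be reached in finite time.\<close>

lemma trajectory_distance: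
  assumes traj: "trajectory Q g t0 V W" "trajectory Q g t0 V' W'"
  defines "d \<equiv> \<lambda>r. \<bar>V r - V' r\<bar> + \<bar>W r - W' r\<bar>"
  assumes st: "t0 \<le> s" "s \<le> t"
  shows "d t \<le> d s * exp ((1 + M * L) * (t - s))" and "d s \<le> d t * exp ((1 + M * L) * (t - s))"
proof -
  let ?K = "1 + M * L"
  have K: "0 \<le> ?K" using M_nonneg L_nonneg by simp
  have dc: "continuous_on S d" if "S \<subseteq> {t0..}" for S
    unfolding d_def
    by (intro continuous_intros continuous_on_subset[OF _ that] V_cont[OF traj(1)] V_cont[OF traj(2)]
        W_cont[OF traj(1)] W_cont[OF traj(2)])
  \<comment> \<open>Bounding the absolute change of \<open>d\<close> treats both time directions at
    once and feeds both Gronwall lemmas.\<close>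
  have *: "\<bar>d q - d p\<bar> \<le> ?K * integral {p..q} d" if pq: "t0 \<le> p" "p \<le> q" for p q
  proof -
    have "d integrable_on {p..q}" using pq by (intro integrable_continuous_interval dc) auto
    then have I: "(d has_integral integral {p..q} d) {p..q}" by (rule integrable_integral)
    have "\<bar>(V q - V p) - (V' q - V' p)\<bar> \<le> integral {p..q} d"
    proof (rule has_integral_abs_le[OF has_integral_diff[OF V_int[OF traj(1) pq] V_int[OF traj(2) pq]] I])
      show "\<bar>psi (W r) - psi (W' r)\<bar> \<le> d r" for r
        using psi_lipschitz[of "W r" "W' r"] by (simp add: d_def)
    qed
    moreover have "\<bar>(W p - W q) - (W' p - W' q)\<bar> \<le> M * L * integral {p..q} d"
    proof (rule has_integral_abs_le[OF has_integral_diff[OF W_int[OF traj(1) pq] W_int[OF traj(2) pq]]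
          has_integral_mult_right[OF I]])
      fix r assume r: "r \<in> {p..q}"
      have "\<bar>Q r * g (V r) - Q r * g (V' r)\<bar> = \<bar>Q r\<bar> * \<bar>g (V r) - g (V' r)\<bar>"
        by (simp add: abs_mult flip: right_diff_distrib)
      also have "\<dots> \<le> M * (L * \<bar>V r - V' r\<bar>)"
        using r pq Q_bound[of r] g_lipschitz[of "V r" "V' r"] M_nonneg by (intro mult_mono) auto
      also have "\<dots> \<le> M * (L * d r)"
        using M_nonneg L_nonneg by (intro mult_left_mono) (auto simp: d_def)
      finally show "\<bar>Q r * g (V r) - Q r * g (V' r)\<bar> \<le> M * L * d r" by simp
    qed
    ultimately show ?thesis unfolding d_def by (simp add: distrib_right)
  qed
  show "d t \<le> d s * exp (?K * (t - s))"
  proof (rule gronwall_forward[OF dc _ K])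
    show "d r \<le> d s + ?K * integral {s..r} d" if "r \<in> {s..t}" for r
      using *[of s r] that st by auto
  qed (use st in auto)
  show "d s \<le> d t * exp (?K * (t - s))"
  proof (rule gronwall_backward[OF dc _ K])
    show "d r \<le> d t + ?K * integral {r..t} d" if "r \<in> {s..t}" for r
      using *[of r t] that st by auto
  qed (use st in auto)
qed

lemma equilibrium_trajectory: "g e = 0 \<Longrightarrow> trajectory Q g t0 (\<lambda>_. e) (\<lambda>_. 0)"
  by (simp add: trajectory_def)

text \<open>The backward distance estimate is applied to the constant trajectory at
  \<open>e\<close>: distance zero at time \<open>t\<close> forces distance zero at
  \<open>t0\<close>.\<close>

lemma equilibrium_unreachable:
  assumes "trajectory Q g t0 V W" "g e = 0" "t0 \<le> t" "V t = e" "W t = 0"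
  shows "V t0 = e"
  using trajectory_distance(2)[OF assms(1) equilibrium_trajectory[OF assms(2)], of t0 t] assms(3-5)
  by simp

end

subsection \<open>Bistable reaction terms and the orbit leaving \<open>0\<close>\<close>

lemma trajectory_increasing:
  assumes "trajectory Q g t0 V W" "t0 \<le> s" "s < t" "\<And>r. s < r \<Longrightarrow> r < t \<Longrightarrow> 0 < W r"
  shows "V s < V t"
proof -
  have W: "continuous_on {s..} W"
    using assms by (intro continuous_on_subset[of "{t0..}" W "{s..}"]) (auto simp: trajectory_def)
  have "(V has_real_derivative psi (W r)) (at r)" if "s < r" for r
  proof -
    have "(V has_real_derivative psi (W r)) (at r within {s..})"
      using assms(1,2) that
      by (intro has_derivative_within_of_has_integral continuous_on_psi W) (auto simp: trajectory_def)
    then show ?thesis using at_within_interior[of r "{s..}"] that by simp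
  qed
  moreover have "continuous_on {s..t} V"
    using assms by (intro continuous_on_subset[of "{t0..}" V "{s..t}"]) (auto simp: trajectory_def)
  ultimately show ?thesis
    using assms(3,4) by (intro DERIV_pos_imp_increasing_open[of s t V]) (auto intro!: exI)
qed

text \<open>Since \<open>psi\<close> is odd, the point reflection of the phase plane preserves the
  form of the system. It turns results on increasing trajectories into results on decreasing
  ones.\<close>

lemma trajectory_reflect:
  assumes "trajectory Q g t0 V W"
  shows "trajectory Q (\<lambda>x. - g (- x)) t0 (\<lambda>t. - V t) (\<lambda>t. - W t)"
proof -
  have "((\<lambda>r. psi (- W r)) has_integral - V t - (- V s)) {s..t}"
       "((\<lambda>r. Q r * - g (- (- V r))) has_integral - W s - (- W t)) {s..t}"
    if "t0 \<le> s" "s \<le> t" for s t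
    using has_integral_neg[of "\<lambda>r. psi (W r)" "V t - V s" "{s..t}"]
      has_integral_neg[of "\<lambda>r. Q r * g (V r)" "W s - W t" "{s..t}"] assms that
    by (auto simp: trajectory_def)
  then show ?thesis
    using assms unfolding trajectory_def by (auto intro!: continuous_intros)
qed

lemma trajectory_decreasing:
  assumes "trajectory Q g t0 V W" "t0 \<le> s" "s < t" "\<And>r. s < r \<Longrightarrow> r < t \<Longrightarrow> W r < 0"
  shows "V t < V s"
  using trajectory_increasing[OF trajectory_reflect[OF assms(1)] assms(2,3)] assms(4) by simp

text \<open>The zeros of \<open>m\<close> in \<open>{t0..t1}\<close> form a nonempty compact set,
  whose minimum is the desired time; an earlier nonnegative value would produce an earlier zero by
  the intermediate value theorem.\<close>

lemma first_nonneg_time: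
  fixes m :: "real \<Rightarrow> real"
  assumes cont: "continuous_on {t0..} m" and "m t0 < 0" "t0 \<le> t1" "0 \<le> m t1"
  obtains \<tau> where "t0 < \<tau>" "\<tau> \<le> t1" "m \<tau> = 0" "\<And>t. t0 \<le> t \<Longrightarrow> t < \<tau> \<Longrightarrow> m t < 0"
proof -
  let ?Z = "{t0..t1} \<inter> m -` {0}"
  have c1: "continuous_on {t0..t1} m" using cont by (rule continuous_on_subset) auto
  have "closed ?Z" by (rule continuous_closed_preimage[OF c1]) auto
  then have cpt: "compact ?Z"
    by (rule compact_eq_bounded_closed[THEN iffD2, OF conjI, rotated]) (auto intro: bounded_subset[of "{t0..t1}"])
  have zero: "\<exists>z\<in>{t0..t}. m z = 0" if "t0 \<le> t" "t \<le> t1" "0 \<le> m t" for t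
    using IVT'[of m t0 0 t] that \<open>m t0 < 0\<close> continuous_on_subset[OF c1, of "{t0..t}"] by auto
  have "?Z \<noteq> {}" using zero[of t1] assms(3,4) by auto
  then obtain \<tau> where \<tau>: "\<tau> \<in> ?Z" "\<And>z. z \<in> ?Z \<Longrightarrow> \<tau> \<le> z"
    using compact_attains_inf[OF cpt] by blast
  show thesis
  proof
    show "m t < 0" if t: "t0 \<le> t" "t < \<tau>" for t
    proof (rule ccontr)
      assume "\<not> m t < 0"
      then obtain z where "z \<in> {t0..t}" "m z = 0" using zero[of t] \<tau>(1) t by auto
      then show False using \<tau>(2)[of z] \<tau>(1) t by auto
    qed
    show "t0 < \<tau>" using \<tau>(1) \<open>m t0 < 0\<close> by (cases "\<tau> = t0") auto
  qed (use \<tau>(1) in auto)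
qed

text \<open>Cut the interval into \<open>n + 1\<close> equal steps: the quadratic losses add up to
  \<open>C * (t - s)\<^sup>2 / (n + 1)\<close>, which tends to 0. No derivative of \<open>H\<close>
  is involved.\<close>

lemma increment_nonneg_of_quadratic_bound:
  fixes H :: "real \<Rightarrow> real"
  assumes "s \<le> t" and le: "\<And>p q. s \<le> p \<Longrightarrow> p \<le> q \<Longrightarrow> q \<le> t \<Longrightarrow> - (C * (q - p)\<^sup>2) \<le> H q - H p"
  shows "H s \<le> H t"
proof -
  have "- (C * (t - s)\<^sup>2) / real (Suc n) \<le> H t - H s" for n
  proof -
    define h where "h = (t - s) / real (Suc n)"
    have h0: "0 \<le> h" using \<open>s \<le> t\<close> by (simp add: h_def)
    have hn: "real (Suc n) * h = t - s" by (simp add: h_def)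
    have "- (real i * (C * h\<^sup>2)) \<le> H (s + real i * h) - H s" if "i \<le> Suc n" for i
      using that
    proof (induction i)
      case (Suc i)
      have "s + real (Suc i) * h \<le> s + real (Suc n) * h"
        using Suc.prems h0 by (intro add_left_mono mult_right_mono) auto
      then have "- (C * (s + real (Suc i) * h - (s + real i * h))\<^sup>2)
          \<le> H (s + real (Suc i) * h) - H (s + real i * h)"
        using h0 hn by (intro le) (auto simp: distrib_right)
      then show ?case using Suc by (simp add: algebra_simps)
    qed simp
    from this[of "Suc n"] have "- (real (Suc n) * (C * h\<^sup>2)) \<le> H t - H s"
      unfolding hn by simp
    moreover have "real (Suc n) * (C * h\<^sup>2) = C * (t - s)\<^sup>2 / real (Suc n)"
      by (simp add: h_def power2_eq_square)
    ultimately show ?thesis by simp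
  qed
  moreover have "(\<lambda>n. - (C * (t - s)\<^sup>2) / real (Suc n)) \<longlonglongrightarrow> 0"
    by (rule LIMSEQ_Suc[OF lim_const_over_n])
  ultimately have "0 \<le> H t - H s" by (intro LIMSEQ_le_const2) auto
  then show ?thesis by simp
qed

section \<open>The bistable nonlinearity, its potential and the autonomous orbit\<close>

locale bistable =
  fixes g :: "real \<Rightarrow> real" and L \<alpha> :: real
  assumes g_lip: "\<And>x y. \<bar>g x - g y\<bar> \<le> L * \<bar>x - y\<bar>"
    and g_zero_left: "\<And>x. x \<le> 0 \<Longrightarrow> g x = 0" and g_zero_right: "\<And>x. 1 \<le> x \<Longrightarrow> g x = 0"
    and \<alpha>: "0 < \<alpha>" "\<alpha> < 1" "g \<alpha> = 0"
    and g_neg: "\<And>x. 0 < x \<Longrightarrow> x < \<alpha> \<Longrightarrow> g x < 0"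
    and g_pos: "\<And>x. \<alpha> < x \<Longrightarrow> x < 1 \<Longrightarrow> 0 < g x"
begin

lemma g_abs_le: "\<bar>g x\<bar> \<le> L"
proof -
  have "0 \<le> L" using g_lip[of 0 1] by simp
  moreover have "\<bar>g x\<bar> \<le> L * \<bar>x\<bar>" using g_lip[of x 0] g_zero_left[of 0] by simp
  moreover have "L * \<bar>x\<bar> \<le> L * 1" if "\<bar>x\<bar> \<le> 1" using that \<open>0 \<le> L\<close> by (rule mult_left_mono)
  ultimately show ?thesis using g_zero_left[of x] g_zero_right[of x] by (cases "\<bar>x\<bar> \<le> 1"; cases "x \<le> 0") auto
qed

lemma system_constant: "0 \<le> c \<Longrightarrow> lipschitz_system (\<lambda>_. c) g t0 c L L"
  by unfold_locales (auto simp: g_lip g_abs_le)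

lemma g_cont: "continuous_on S g"
  using lipschitz_system.g_continuous[OF system_constant[of 0 0]] by simp

definition G :: "real \<Rightarrow> real" where
  "G x = integral {0..x} g"

lemma G_deriv: "(G has_real_derivative g x) (at x)"
proof -
  \<comment> \<open>The base point moves strictly to the left of both \<open>x\<close> and 0, so
    that \<open>x\<close> is interior even when \<open>x \<le> 0\<close>. The primitive does not
    change, as \<open>g\<close> vanishes on the negative half-line.\<close>
  define a where "a = min x 0 - 1"
  have int: "g integrable_on {p..q}" for p q by (intro integrable_continuous_interval g_cont)
  have "((\<lambda>y. integral {a..y} g) has_real_derivative g x) (at x)"
    using integral_has_real_derivative[OF g_cont, of x a "x + 1"] at_within_Icc_at[of a x "x + 1"]
    by (simp add: a_def)
  then show ?thesis
  proof (rule has_field_derivative_transform_within_open[of _ _ _ "{a<..}"])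
    fix y assume y: "y \<in> {a<..}"
    have zero: "integral {a..z} g = 0" if "z \<le> 0" for z
      using integral_cong[of "{a..z}" g "\<lambda>_. 0"] that g_zero_left by auto
    show "integral {a..y} g = G y"
    proof (cases "0 \<le> y")
      case True
      have "integral {a..0} g + integral {0..y} g = integral {a..y} g"
        using True by (intro Henstock_Kurzweil_Integration.integral_combine int) (auto simp: a_def)
      then show ?thesis using zero[of 0] by (simp add: G_def)
    qed (use zero[of y] in \<open>auto simp: G_def\<close>)
  qed (auto simp: a_def)
qed

lemma G_cont: "continuous_on S G"
  using G_deriv by (meson DERIV_continuous continuous_at_imp_continuous_on)

lemma G_0 [simp]: "G 0 = 0" by (simp add: G_def)

lemma G_decreasing: "0 \<le> x \<Longrightarrow> x < y \<Longrightarrow> y \<le> \<alpha> \<Longrightarrow> G y < G x"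
  by (rule DERIV_neg_imp_decreasing_open) (auto intro!: exI conjI G_deriv g_neg intro: G_cont)

lemma G_increasing: "\<alpha> \<le> x \<Longrightarrow> x < y \<Longrightarrow> y \<le> 1 \<Longrightarrow> G x < G y"
  by (rule DERIV_pos_imp_increasing_open) (auto intro!: exI conjI G_deriv g_pos intro: G_cont)

lemma G_\<alpha>_neg: "G \<alpha> < 0"
  using G_decreasing[of 0 \<alpha>] \<alpha> by simp

text \<open>\<open>G\<close> falls from 0 to \<open>G \<alpha> < 0\<close> and then rises to
  \<open>G 1 > 0\<close>, so it crosses 0 between \<alpha> and 1. The level \<open>z\<close> is
  where the autonomous orbit leaving 0 has used up its momentum.\<close>

lemma G_zero_exists:
  assumes "0 < G 1"
  obtains z where "\<alpha> < z" "z < 1" "G z = 0" "\<forall>x\<in>{0<..<z}. G x < 0"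
proof -
  obtain z where z: "\<alpha> \<le> z" "z \<le> 1" "G z = 0"
    using IVT'[of G \<alpha> 0 1] assms \<alpha> G_\<alpha>_neg G_cont by auto
  show thesis
  proof
    show "\<alpha> < z" using z G_\<alpha>_neg by (cases "z = \<alpha>") auto
    show "z < 1" using z assms by (cases "z = 1") auto
    show "\<forall>x\<in>{0<..<z}. G x < 0"
    proof
      fix x assume "x \<in> {0<..<z}"
      then show "G x < 0"
        using z G_decreasing[of 0 x] G_increasing[of x z] by (cases "x \<le> \<alpha>") auto
    qed
  qed (use z in auto)
qed

text \<open>The value of \<open>\<phi>(v')\<close> at level \<open>a\<close> on the orbit of the autonomous equation
  \<open>(\<phi>(v'))' + c g(v) = 0\<close> that leaves the equilibrium \<open>0\<close>.\<close>

definition orbit_momentum :: "real \<Rightarrow> real \<Rightarrow> real" where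
  "orbit_momentum c a = sqrt ((1 - c * G a)\<^sup>2 - 1)"

lemma orbit_momentum_cont: "continuous_on S (orbit_momentum c)"
  unfolding orbit_momentum_def by (intro continuous_intros G_cont)

text \<open>The conserved energy \<open>sqrt (1 + w\<^sup>2) + c * G a\<close> has the value 1 at
  the equilibrium \<open>(0, 0)\<close>, hence on the orbit leaving it. The sign conditions give
  \<open>1 - c * G a \<ge> 1\<close>, so the square root is genuine.\<close>

lemma orbit_momentum_energy:
  assumes "0 \<le> c" "G a \<le> 0"
  shows "sqrt (1 + (orbit_momentum c a)\<^sup>2) = 1 - c * G a"
proof -
  have "0 \<le> - c * G a" using assms mult_nonneg_nonpos[of c "G a"] by simp
  then have "1 \<le> 1 - c * G a" by simp
  then have "1 \<le> (1 - c * G a)\<^sup>2" by (rule one_le_power)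
  then show ?thesis using \<open>1 \<le> 1 - c * G a\<close> by (simp add: orbit_momentum_def)
qed

lemma orbit_momentum_pos: "0 < c \<Longrightarrow> G a < 0 \<Longrightarrow> 0 < orbit_momentum c a"
  using mult_pos_neg[of c "G a"] one_less_power[of "1 - c * G a" 2] by (simp add: orbit_momentum_def)

text \<open>Time reversal flips the sign of the momentum, so the past of the orbit appears here as a
  forward trajectory descending from \<open>a\<close> to 0. Conservation of energy ties the momentum
  to the position, and the momentum cannot vanish while the position is in
  \<open>]0, z[\<close>.\<close>

lemma backward_orbit:
  assumes c: "0 < c" and z: "G z = 0" "\<forall>x\<in>{0<..<z}. G x < 0" and a: "0 < a" "a < z"
  obtains V W where "trajectory (\<lambda>_. c) g t0 V W" "V t0 = a" "W t0 = - orbit_momentum c a"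
    "\<forall>t\<ge>t0. 0 < V t \<and> W t < 0" "(V \<longlongrightarrow> 0) at_top"
proof -
  interpret lipschitz_system "\<lambda>_. c" g t0 c L L using c by (intro system_constant) simp
  obtain V W where traj: "trajectory (\<lambda>_. c) g t0 V W" and init: "V t0 = a" "W t0 = - orbit_momentum c a"
    using trajectory_exists by blast
  have Ga: "G a < 0" using z a by auto
  have energy: "sqrt (1 + (W t)\<^sup>2) = 1 - c * G (V t)" if t: "t0 \<le> t" for t
  proof -
    \<comment> \<open>The coefficient is constant here, so \<open>W\<close> is differentiable
      everywhere and the energy is exactly conserved.\<close>
    let ?E = "\<lambda>t. sqrt (1 + (W t)\<^sup>2) + c * G (V t)"
    have "(?E has_real_derivative 0) (at r within {t0..})" if r: "r \<in> {t0..}" for r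
    proof -
      have "((\<lambda>t. sqrt (1 + (W t)\<^sup>2)) has_real_derivative psi (W r) * - (c * g (V r))) (at r within {t0..})"
        using W_deriv[OF traj, of r] r by (intro DERIV_chain2[OF DERIV_sqrt_one_plus_square]) auto
      moreover have "((\<lambda>t. G (V t)) has_real_derivative g (V r) * psi (W r)) (at r within {t0..})"
        using V_deriv[OF traj, of r] r by (intro DERIV_chain2[OF G_deriv]) auto
      then have "((\<lambda>t. c * G (V t)) has_real_derivative c * (g (V r) * psi (W r))) (at r within {t0..})"
        by (rule DERIV_cmult)
      ultimately show ?thesis by (rule DERIV_add[THEN DERIV_cong]) simp
    qed
    then obtain e where e: "\<And>r. r \<in> {t0..} \<Longrightarrow> ?E r = e"
      using has_field_derivative_zero_constant[of "{t0..}" ?E] by auto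
    have "?E t0 = 1" using orbit_momentum_energy[of c a] c Ga init by simp
    then show ?thesis using e[of t] e[of t0] t by simp
  qed
  have not_exit: "0 < V t \<and> W t < 0" if t: "t0 \<le> t" for t
  proof (rule ccontr)
    assume "\<not> (0 < V t \<and> W t < 0)"
    \<comment> \<open>The maximum is negative exactly while both conditions hold, so its first zero
      is the first failure of either one.\<close>
    then have "0 \<le> max (W t) (- V t)" by auto
    moreover have "max (W t0) (- V t0) < 0" using init a orbit_momentum_pos[OF c Ga] by auto
    moreover have "continuous_on {t0..} (\<lambda>t. max (W t) (- V t))"
      by (intro continuous_intros V_cont[OF traj] W_cont[OF traj])
    ultimately obtain \<tau> where \<tau>: "t0 < \<tau>" "max (W \<tau>) (- V \<tau>) = 0"
      and before: "\<And>r. t0 \<le> r \<Longrightarrow> r < \<tau> \<Longrightarrow> max (W r) (- V r) < 0"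
      using first_nonneg_time[of t0 "\<lambda>t. max (W t) (- V t)" t] t by blast
    have "V \<tau> < V t0"
      using before \<tau> by (intro trajectory_decreasing[OF traj]) auto
    moreover have "0 \<le> V \<tau>" using \<tau> by auto
    moreover have "W \<tau> = 0" if "V \<tau> = 0" using energy[of \<tau>] that \<tau>(1) by simp
    moreover have "G (V \<tau>) = 0" if "W \<tau> = 0" using energy[of \<tau>] that \<tau>(1) c by simp
    moreover have "V \<tau> = 0 \<or> W \<tau> = 0" using \<tau>(2) by linarith
    \<comment> \<open>By the energy identity, zero position forces zero momentum, while zero
      momentum forces \<open>G (V \<tau>) = 0\<close> with \<open>V \<tau>\<close> in
      \<open>[0, z[\<close>, hence zero position. Either failure would thus mean arrival at the
      equilibrium.\<close>
    ultimately have "V \<tau> = 0" "W \<tau> = 0"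
      using z(2)[rule_format, of "V \<tau>"] a init by fastforce+
    then have "V t0 = 0" using equilibrium_unreachable[OF traj, of 0 \<tau>] \<tau>(1) g_zero_left[of 0] by simp
    then show False using init a by simp
  qed
  have decr: "V t \<le> V s" if "t0 \<le> s" "s \<le> t" for s t
    using trajectory_decreasing[OF traj, of s t] not_exit that by (cases "s = t") (auto intro: less_imp_le)
  have ex: "\<exists>t\<ge>t0. V t < e" if e: "0 < e" for e
  proof (rule ccontr)
    assume "\<not> (\<exists>t\<ge>t0. V t < e)"
    then have ge: "e \<le> V t" if "t0 \<le> t" for t using that by force
    then have ea: "e \<le> a" using init by force
    \<comment> \<open>The maximum point of \<open>G\<close> on the band has the least kinetic
      energy, so its momentum \<open>k\<close> bounds the descent speed from below.\<close>
    obtain x where x: "x \<in> {e..a}" "\<And>y. y \<in> {e..a} \<Longrightarrow> G y \<le> G x"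
      using continuous_attains_sup[of "{e..a}" G] ea G_cont by auto
    have Gx: "G x < 0" using x(1) e a z(2) by auto
    define k where "k = orbit_momentum c x"
    have k: "0 < k" unfolding k_def by (rule orbit_momentum_pos[OF c Gx])
    have W: "W t \<le> - k" if t: "t0 \<le> t" for t
    proof -
      have "c * G (V t) \<le> c * G x"
        using ge[OF t] decr[of t0 t] t init c by (intro mult_left_mono x(2)) auto
      then have "sqrt (1 + k\<^sup>2) \<le> sqrt (1 + (W t)\<^sup>2)"
        using energy[OF t] orbit_momentum_energy[of c x] c Gx by (simp add: k_def)
      then have "k\<^sup>2 \<le> (- W t)\<^sup>2" by simp
      then have "k \<le> - W t" by (rule power2_le_imp_le) (simp add: not_exit[OF t] less_imp_le)
      then show ?thesis by simp
    qed
    \<comment> \<open>At speed at least \<open>psi k\<close> the whole distance \<open>a\<close>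
      down to 0 is covered by time \<open>T\<close>.\<close>
    define T where "T = t0 + a / psi k"
    have pk: "0 < psi k" using k by simp
    have T: "t0 \<le> T" using divide_pos_pos[OF a(1) pk] by (simp add: T_def)
    have "V T - V t0 \<le> - psi k * (T - t0)"
    proof -
      have "psi (W r) \<le> - psi k" if "r \<in> {t0..T}" for r using psi_mono[OF W[of r]] that by auto
      then show ?thesis
        using has_integral_le[OF V_int[OF traj _ T] has_integral_const_real[of "- psi k" t0 T]] T
        by (simp add: mult.commute)
    qed
    moreover have "psi k * (T - t0) = a" using pk by (simp add: T_def del: psi_pos_iff)
    ultimately have "V T \<le> 0" using init by simp
    then show False using not_exit[OF T] by linarith
  qed
  have "eventually (\<lambda>t. V t < y) at_top" if y: "0 < y" for y
  proof -
    obtain t where t: "t0 \<le> t" "V t < y" using ex[OF y] by blast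
    have "V r < y" if "t \<le> r" for r using decr[OF t(1) that] t(2) by linarith
    then show ?thesis unfolding eventually_at_top_linorder by blast
  qed
  moreover have "eventually (\<lambda>t. y < V t) at_top" if "y < 0" for y
    using eventually_ge_at_top[of t0] by eventually_elim (use not_exit that in force)
  ultimately have "(V \<longlongrightarrow> 0) at_top" by (intro order_tendstoI) auto
  then show thesis using that[OF traj init] not_exit by blast
qed

end

subsection \<open>Shooting\<close>

lemma continuous_on_right_interval:
  fixes h :: "real \<Rightarrow> real"
  assumes "continuous_on {t0..} h" "t0 \<le> t" "0 < e"
  obtains d where "0 < d" "\<And>r. t \<le> r \<Longrightarrow> r \<le> t + d \<Longrightarrow> \<bar>h r - h t\<bar> < e"
proof -
  obtain d where d: "0 < d" "\<And>r. t0 \<le> r \<Longrightarrow> \<bar>r - t\<bar> < d \<Longrightarrow> \<bar>h r - h t\<bar> < e"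
    using assms unfolding continuous_on_iff dist_real_def by (metis atLeast_iff)
  show thesis
    by (rule that[of "d / 2"]) (use d assms(2) in auto)
qed

text \<open>The strict inequalities on a compact time interval are stable under uniform
  perturbation, which makes the corresponding set of shooting levels open. The same design is used
  for \<open>overshoots\<close>.\<close>

definition turns :: "real \<Rightarrow> (real \<Rightarrow> real) \<Rightarrow> (real \<Rightarrow> real) \<Rightarrow> bool" where
  "turns t0 V W \<longleftrightarrow> (\<exists>s\<ge>t0. W s < 0 \<and> (\<forall>t\<in>{t0..s}. V t < 1))"

definition overshoots :: "real \<Rightarrow> (real \<Rightarrow> real) \<Rightarrow> (real \<Rightarrow> real) \<Rightarrow> bool" where
  "overshoots t0 V W \<longleftrightarrow> (\<exists>s\<ge>t0. 1 < V s \<and> (\<forall>t\<in>{t0..s}. 0 < W t))"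

text \<open>At the earlier of the two witness times the other property is contradicted.\<close>

lemma not_turns_and_overshoots: "turns t0 V W \<Longrightarrow> overshoots t0 V W \<Longrightarrow> False"
proof -
  assume "turns t0 V W" "overshoots t0 V W"
  then obtain s s' where "t0 \<le> s" "W s < 0" "\<forall>t\<in>{t0..s}. V t < 1"
    and "t0 \<le> s'" "1 < V s'" "\<forall>t\<in>{t0..s'}. 0 < W t"
    unfolding turns_def overshoots_def by blast
  then show False by (cases "s \<le> s'") force+
qed

text \<open>The bounds on \<open>Q\<close> hold at every time, which the application arranges by
  changing the coefficient on a null set. \<open>balance\<close> is the hypothesis on
  \<open>c\<close> with its denominator cleared.\<close>

locale forward_problem = bistable +
  fixes Q :: "real \<Rightarrow> real" and t0 \<eta> N c :: real
  assumes Q_meas: "Q \<in> borel_measurable (lebesgue_on {t0..})"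
    and Q_lower: "\<And>t. t0 \<le> t \<Longrightarrow> \<eta> \<le> Q t" and Q_upper: "\<And>t. t0 \<le> t \<Longrightarrow> Q t \<le> N"
    and \<eta>_pos: "0 < \<eta>" and c_pos: "0 < c"
    and balance: "N * (G 1 - G \<alpha>) \<le> c * (- G \<alpha>)"
begin

sublocale lipschitz_system Q g t0 N L L
proof
  show "\<bar>Q t\<bar> \<le> N" if "t0 \<le> t" for t
    using Q_lower[OF that] Q_upper[OF that] \<eta>_pos by linarith
qed (auto simp: Q_meas g_lip g_abs_le)

lemma N_pos: "0 < N" using Q_lower[of t0] Q_upper[of t0] \<eta>_pos by linarith

text \<open>On a compact band inside \<open>]\<alpha>, 1[\<close> the force is at least \<eta> times
  the positive minimum of \<open>g\<close>, which gives a uniform rate of loss of momentum.\<close>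

lemma W_decrease:
  assumes traj: "trajectory Q g t0 V W" and "\<alpha> < x" "x \<le> y" "y < 1"
  obtains k where "0 < k" "\<And>s t. t0 \<le> s \<Longrightarrow> s \<le> t \<Longrightarrow>
    (\<And>r. s \<le> r \<Longrightarrow> r \<le> t \<Longrightarrow> V r \<in> {x..y}) \<Longrightarrow> W t \<le> W s - k * (t - s)"
proof -
  obtain u where u: "u \<in> {x..y}" "\<And>w. w \<in> {x..y} \<Longrightarrow> g u \<le> g w"
    using continuous_attains_inf[of "{x..y}" g] assms g_cont by auto
  have gu: "0 < g u" using u(1) assms by (intro g_pos) auto
  show thesis
  proof
    show "0 < \<eta> * g u" using gu \<eta>_pos by simp
    fix s t
    assume st: "t0 \<le> s" "s \<le> t"
      and V: "\<And>r. s \<le> r \<Longrightarrow> r \<le> t \<Longrightarrow> V r \<in> {x..y}"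
    have "\<eta> * g u \<le> Q r * g (V r)" if "r \<in> {s..t}" for r
      using Q_lower[of r] u(2)[OF V, of r] that st gu \<eta>_pos by (intro mult_mono) auto
    then have "\<eta> * g u * (t - s) \<le> W s - W t"
      using has_integral_le[OF has_integral_const_real[of "\<eta> * g u" s t] W_int[OF traj st]] st
      by (simp add: mult.commute)
    then show "W t \<le> W s - \<eta> * g u * (t - s)" by simp
  qed
qed

text \<open>\<open>W\<close> is only Lipschitz, so the monotonicity of the energy is obtained from the convexity of
  \<open>\<lambda>w. sqrt (1 + w\<^sup>2)\<close>: on a short interval the energy can only decrease by a quadratic amount.\<close>

lemma energy_nondecreasing:
  assumes traj: "trajectory Q g t0 V W" and \<tau>: "t0 \<le> \<tau>"
    and W: "\<And>r. t0 \<le> r \<Longrightarrow> r \<le> \<tau> \<Longrightarrow> 0 \<le> W r"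
    and V: "\<And>r. t0 \<le> r \<Longrightarrow> r \<le> \<tau> \<Longrightarrow> \<alpha> \<le> V r \<and> V r \<le> 1"
  shows "sqrt (1 + (W t0)\<^sup>2) + N * G (V t0) \<le> sqrt (1 + (W \<tau>)\<^sup>2) + N * G (V \<tau>)"
proof (rule increment_nonneg_of_quadratic_bound[OF \<tau>,
      where H = "\<lambda>t. sqrt (1 + (W t)\<^sup>2) + N * G (V t)" and C = "N * (L * (N * L))"])
  fix p q assume pq: "t0 \<le> p" "p \<le> q" "q \<le> \<tau>"
  define I where "I = integral {p..q} (\<lambda>r. g (V r))"
  have "continuous_on {p..q} (\<lambda>r. g (V r))"
    using continuous_on_compose2[OF g_cont[of UNIV] continuous_on_subset[OF V_cont[OF traj]], of "{p..q}"] pq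
    by auto
  then have I: "((\<lambda>r. g (V r)) has_integral I) {p..q}"
    unfolding I_def by (intro integrable_integral integrable_continuous_interval)
  have gV: "0 \<le> g (V r)" if "r \<in> {p..q}" for r
    using V[of r] that pq g_pos[of "V r"] \<alpha>(3) g_zero_right[of "V r"]
    by (cases "V r = \<alpha>"; cases "V r = 1") auto
  have "((\<lambda>r. N * g (V r)) has_integral N * I) {p..q}" by (rule has_integral_mult_right[OF I])
  then have "W p - W q \<le> N * I"
    by (rule has_integral_le[OF W_int[OF traj pq(1,2)]])
      (use gV Q_upper pq in \<open>auto intro!: mult_right_mono\<close>)
  then have "psi (W p) * (- (N * I)) \<le> psi (W p) * (W q - W p)"
    using W[of p] pq psi_mono[of 0 "W p"] by (intro mult_left_mono) auto
  then have 1: "- (N * (psi (W p) * I)) \<le> sqrt (1 + (W q)\<^sup>2) - sqrt (1 + (W p)\<^sup>2)"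
    using sqrt_one_plus_square_tangent[of "W p" "W q"] by (simp add: algebra_simps)
  have "((\<lambda>t. G (V t)) has_real_derivative g (V r) * psi (W r)) (at r within {p..q})" if "r \<in> {p..q}" for r
    using that pq by (intro DERIV_chain2[OF G_deriv] DERIV_subset[OF V_deriv[OF traj]]) auto
  then have "((\<lambda>r. g (V r) * psi (W r)) has_integral G (V q) - G (V p)) {p..q}"
    using pq by (intro fundamental_theorem_of_calculus)
      (auto simp flip: has_real_derivative_iff_has_vector_derivative)
  from has_integral_diff[OF this has_integral_mult_right[OF I, of "psi (W p)"]]
  have "\<bar>G (V q) - G (V p) - psi (W p) * I\<bar> \<le> (L * (N * L * (q - p))) * (q - p)"
  proof (rule has_integral_abs_le_const)
    fix r assume r: "r \<in> {p..q}"
    have "\<bar>psi (W r) - psi (W p)\<bar> \<le> N * L * (r - p)"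
      using psi_lipschitz[of "W r" "W p"] W_lipschitz[OF traj, of p r] r pq by auto
    also have "\<dots> \<le> N * L * (q - p)"
      using r N_pos L_nonneg by (intro mult_left_mono) auto
    finally have "\<bar>g (V r)\<bar> * \<bar>psi (W r) - psi (W p)\<bar> \<le> L * (N * L * (q - p))"
      using g_abs_le[of "V r"] L_nonneg by (intro mult_mono) auto
    then show "\<bar>g (V r) * psi (W r) - psi (W p) * g (V r)\<bar> \<le> L * (N * L * (q - p))"
      by (simp only: abs_mult[symmetric] right_diff_distrib mult.commute[of "psi (W p)"])
  qed (use pq in auto)
  then have "- (L * (N * L * (q - p)) * (q - p)) \<le> G (V q) - G (V p) - psi (W p) * I"
    by linarith
  from mult_left_mono[OF this, of N]
  have 2: "- (N * (L * (N * L)) * (q - p)\<^sup>2) \<le> N * (G (V q) - G (V p) - psi (W p) * I)"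
    using N_pos by (simp add: power2_eq_square mult_ac)
  show "- (N * (L * (N * L)) * (q - p)\<^sup>2) \<le> sqrt (1 + (W q)\<^sup>2) + N * G (V q) - (sqrt (1 + (W p)\<^sup>2) + N * G (V p))"
    using 1 2 by (simp add: algebra_simps)
qed

text \<open>At the first zero \<tau> of the momentum, the energy inequality reads \<open>1 - c * G
  \<alpha> + N * G \<alpha> \<le> 1 + N * G (V \<tau>)\<close>. With \<open>balance\<close> this
  gives \<open>G 1 \<le> G (V \<tau>)\<close>, impossible for a level in
  \<open>[\<alpha>, 1[\<close>.\<close>

lemma not_turns_from_\<alpha>:
  assumes traj: "trajectory Q g t0 V W" and init: "V t0 = \<alpha>" "W t0 = orbit_momentum c \<alpha>"
  shows "\<not> turns t0 V W"
proof
  assume "turns t0 V W"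
  then obtain s where s: "t0 \<le> s" "W s < 0" and V1: "\<And>t. t0 \<le> t \<Longrightarrow> t \<le> s \<Longrightarrow> V t < 1"
    unfolding turns_def by auto
  have "- W t0 < 0" using init orbit_momentum_pos[OF c_pos G_\<alpha>_neg] by simp
  moreover have "continuous_on {t0..} (\<lambda>t. - W t)" by (intro continuous_intros W_cont[OF traj])
  ultimately obtain \<tau> where \<tau>: "t0 < \<tau>" "\<tau> \<le> s" "W \<tau> = 0"
    and before: "\<And>r. t0 \<le> r \<Longrightarrow> r < \<tau> \<Longrightarrow> 0 < W r"
    using first_nonneg_time[of t0 "\<lambda>t. - W t" s] s by auto
  have ge: "\<alpha> \<le> V r" if "t0 \<le> r" "r \<le> \<tau>" for r
    using trajectory_increasing[OF traj, of t0 r] before that init by (cases "r = t0") auto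
  have "sqrt (1 + (W t0)\<^sup>2) + N * G (V t0) \<le> sqrt (1 + (W \<tau>)\<^sup>2) + N * G (V \<tau>)"
  proof (rule energy_nondecreasing[OF traj])
    show "0 \<le> W r" if "t0 \<le> r" "r \<le> \<tau>" for r
      using before[of r] \<tau>(3) that by (cases "r = \<tau>") auto
    show "\<alpha> \<le> V r \<and> V r \<le> 1" if "t0 \<le> r" "r \<le> \<tau>" for r
      using ge[OF that] V1[of r] that \<tau> by auto
  qed (use \<tau> in auto)
  then have "N * G 1 \<le> N * G (V \<tau>)"
    using init \<tau>(3) orbit_momentum_energy[of c \<alpha>] c_pos G_\<alpha>_neg balance by (simp add: algebra_simps)
  then have "G 1 \<le> G (V \<tau>)" using N_pos by simp
  then show False using G_increasing[of "V \<tau>" 1] ge[of \<tau>] V1[of \<tau>] \<tau> by auto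
qed

text \<open>Just after \<tau> the position stays in a band inside \<open>]\<alpha>, 1[\<close>,
  where the momentum falls strictly and so becomes negative.\<close>

lemma turns_if_stops:
  assumes traj: "trajectory Q g t0 V W" and \<tau>: "t0 \<le> \<tau>" "W \<tau> = 0" "\<alpha> < V \<tau>"
    and V1: "\<And>t. t0 \<le> t \<Longrightarrow> t \<le> \<tau> \<Longrightarrow> V t < 1"
  shows "turns t0 V W"
proof -
  have "V \<tau> < 1" using V1 \<tau> by auto
  define e where "e = min (V \<tau> - \<alpha>) (1 - V \<tau>) / 2"
  have e: "0 < e" using \<tau>(3) \<open>V \<tau> < 1\<close> by (simp add: e_def)
  obtain d where d: "0 < d" "\<And>r. \<tau> \<le> r \<Longrightarrow> r \<le> \<tau> + d \<Longrightarrow> \<bar>V r - V \<tau>\<bar> < e"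
    using continuous_on_right_interval[OF V_cont[OF traj] \<tau>(1) e] by blast
  have ee: "\<alpha> < V \<tau> - e" "V \<tau> + e < 1" using e by (auto simp: e_def min_def field_simps split: if_splits)
  obtain k where k: "0 < k" "\<And>s t. t0 \<le> s \<Longrightarrow> s \<le> t \<Longrightarrow>
    (\<And>r. s \<le> r \<Longrightarrow> r \<le> t \<Longrightarrow> V r \<in> {V \<tau> - e..V \<tau> + e}) \<Longrightarrow> W t \<le> W s - k * (t - s)"
    using W_decrease[OF traj ee(1) _ ee(2)] e by auto
  have "W (\<tau> + d) \<le> W \<tau> - k * (\<tau> + d - \<tau>)"
  proof (rule k(2)[OF \<tau>(1)])
    show "V r \<in> {V \<tau> - e..V \<tau> + e}" if "\<tau> \<le> r" "r \<le> \<tau> + d" for r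
      using d(2)[OF that] by auto
  qed (use d in auto)
  also have "\<dots> < 0" using k(1) d(1) \<tau>(2) by simp
  finally have "W (\<tau> + d) < 0" .
  moreover have "V t < 1" if "t \<in> {t0..\<tau> + d}" for t
    using that V1[of t] d(2)[of t] ee by (cases "t \<le> \<tau>") auto
  ultimately show ?thesis unfolding turns_def using d(1) \<tau>(1) by (intro exI[of _ "\<tau> + d"]) auto
qed

lemma overshoots_if_reaches:
  assumes traj: "trajectory Q g t0 V W" and \<tau>: "t0 \<le> \<tau>" "V \<tau> = 1"
    and W: "\<And>t. t0 \<le> t \<Longrightarrow> t \<le> \<tau> \<Longrightarrow> 0 < W t"
  shows "overshoots t0 V W"
proof -
  have "0 < W \<tau>" using W \<tau> by auto
  then obtain d where d: "0 < d" "\<And>r. \<tau> \<le> r \<Longrightarrow> r \<le> \<tau> + d \<Longrightarrow> \<bar>W r - W \<tau>\<bar> < W \<tau>"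
    using continuous_on_right_interval[OF W_cont[OF traj] \<tau>(1)] by blast
  have pos: "0 < W t" if "t \<in> {t0..\<tau> + d}" for t
    using that W[of t] d(2)[of t] by (cases "t \<le> \<tau>") auto
  have "V \<tau> < V (\<tau> + d)"
    using d(1) \<tau>(1) pos by (intro trajectory_increasing[OF traj]) auto
  then show ?thesis unfolding overshoots_def using d(1) \<tau> pos by (intro exI[of _ "\<tau> + d"]) auto
qed

text \<open>At the first time when \<open>W > 0\<close> or \<open>V < 1\<close> fails there are
  three cases. Stopping below 1 means turning, reaching 1 with momentum means overshooting, and
  arriving at \<open>(1, 0)\<close> is excluded because it is an equilibrium.\<close>

lemma forward_dichotomy:
  assumes traj: "trajectory Q g t0 V W" and init: "\<alpha> \<le> V t0" "V t0 < 1" "0 < W t0"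
    and fails: "t0 \<le> t1" "W t1 \<le> 0 \<or> 1 \<le> V t1"
  shows "turns t0 V W \<or> overshoots t0 V W"
proof -
  let ?m = "\<lambda>t. max (- W t) (V t - 1)"
  have "continuous_on {t0..} ?m" by (intro continuous_intros V_cont[OF traj] W_cont[OF traj])
  moreover have "?m t0 < 0" "0 \<le> ?m t1" using init fails by auto
  ultimately obtain \<tau> where \<tau>: "t0 < \<tau>" "?m \<tau> = 0"
    and before: "\<And>r. t0 \<le> r \<Longrightarrow> r < \<tau> \<Longrightarrow> ?m r < 0"
    using first_nonneg_time[of t0 ?m t1] fails by blast
  have V: "V t0 < V \<tau>" using before \<tau> by (intro trajectory_increasing[OF traj]) auto
  have before': "0 < W r" "V r < 1" if "t0 \<le> r" "r < \<tau>" for r using before[OF that] by auto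
  consider "W \<tau> = 0" "V \<tau> = 1" | "W \<tau> = 0" "V \<tau> < 1" | "0 < W \<tau>" "V \<tau> = 1"
    using \<tau>(2) by linarith
  then show ?thesis
  proof cases
    case 1
    then have "V t0 = 1" using equilibrium_unreachable[OF traj, of 1 \<tau>] \<tau> g_zero_right[of 1] by simp
    then show ?thesis using init by simp
  next
    case 2
    have "V t < 1" if "t0 \<le> t" "t \<le> \<tau>" for t using before'[of t] 2 that by (cases "t = \<tau>") auto
    then show ?thesis using turns_if_stops[OF traj, of \<tau>] 2 V init \<tau> by auto
  next
    case 3
    have "0 < W t" if "t0 \<le> t" "t \<le> \<tau>" for t using before'[of t] 3 that by (cases "t = \<tau>") auto
    then show ?thesis using overshoots_if_reaches[OF traj, of \<tau>] 3 \<tau> by auto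
  qed
qed

text \<open>If the increasing position stayed below some \<open>y < 1\<close>, it would remain in a
  band where the momentum decreases at a fixed rate, and the momentum would be exhausted in finite
  time.\<close>

lemma forward_limit:
  assumes traj: "trajectory Q g t0 V W" and init: "\<alpha> \<le> V t0"
    and W: "\<And>t. t0 \<le> t \<Longrightarrow> 0 < W t" and V: "\<And>t. t0 \<le> t \<Longrightarrow> V t < 1"
  shows "(V \<longlongrightarrow> 1) at_top"
proof -
  have incr: "V s < V t" if "t0 \<le> s" "s < t" for s t
    using W that by (intro trajectory_increasing[OF traj]) auto
  have ex: "\<exists>t\<ge>t0. y < V t" if y: "y < 1" for y
  proof (rule ccontr)
    assume "\<not> (\<exists>t\<ge>t0. y < V t)"
    then have le: "V t \<le> y" if "t0 \<le> t" for t using that by force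
    \<comment> \<open>The initial level may be \<alpha>, where \<open>g\<close> vanishes; waiting
      one unit of time moves the position strictly above \<alpha>.\<close>
    let ?s = "t0 + 1"
    have x: "\<alpha> < V ?s" using incr[of t0 ?s] init by simp
    obtain k where k: "0 < k" "\<And>s t. t0 \<le> s \<Longrightarrow> s \<le> t \<Longrightarrow>
      (\<And>r. s \<le> r \<Longrightarrow> r \<le> t \<Longrightarrow> V r \<in> {V ?s..y}) \<Longrightarrow> W t \<le> W s - k * (t - s)"
      using W_decrease[OF traj x le y] by auto
    define T where "T = ?s + W ?s / k"
    have T: "?s \<le> T" using W[of ?s] k(1) by (simp add: T_def)
    have "W T \<le> W ?s - k * (T - ?s)"
    proof (rule k(2)[OF _ T])
      show "V r \<in> {V ?s..y}" if "?s \<le> r" "r \<le> T" for r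
        using le[of r] incr[of ?s r] that by (cases "r = ?s") auto
    qed simp
    also have "\<dots> = 0" using k(1) by (simp add: T_def)
    finally show False using W[of T] T by simp
  qed
  have "eventually (\<lambda>t. y < V t) at_top" if y: "y < 1" for y
  proof -
    obtain t where "t0 \<le> t" "y < V t" using ex[OF y] by blast
    then have "y < V r" if "t < r" for r using incr[of t r] that by linarith
    then show ?thesis unfolding eventually_at_top_dense by blast
  qed
  moreover have "eventually (\<lambda>t. V t < y) at_top" if "1 < y" for y
    using eventually_ge_at_top[of t0] by eventually_elim (use V that in force)
  ultimately show ?thesis by (intro order_tendstoI) auto
qed

lemma forward_orbit:
  assumes z: "\<alpha> < z" "z < 1" "G z = 0" "\<forall>x\<in>{0<..<z}. G x < 0"
  obtains V W a where "\<alpha> \<le> a" "a < z" "trajectory Q g t0 V W" "V t0 = a" "W t0 = orbit_momentum c a"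
    "\<forall>t\<ge>t0. 0 < W t \<and> V t < 1" "(V \<longlongrightarrow> 1) at_top"
proof -
  have "\<forall>a. \<exists>V W. trajectory Q g t0 V W \<and> V t0 = a \<and> W t0 = orbit_momentum c a"
    using trajectory_exists by metis
  then obtain V W where traj: "\<And>a. trajectory Q g t0 (V a) (W a)"
    and init: "\<And>a. V a t0 = a" "\<And>a. W a t0 = orbit_momentum c a"
    by metis
  let ?S = "{\<alpha>..z}"
  \<comment> \<open>Continuous dependence, uniform on each compact time interval: the initial
    distance depends continuously on the level and is amplified by at most the fixed factor
    \<open>?E\<close>.\<close>
  have close: "\<forall>\<^sub>F b in at a within ?S. \<forall>t\<in>{t0..s}. \<bar>V b t - V a t\<bar> < e \<and> \<bar>W b t - W a t\<bar> < e"
    if a: "a \<in> ?S" and e: "0 < e" for a s e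
  proof -
    let ?E = "exp ((1 + N * L) * (s - t0))"
    have "continuous_on ?S (\<lambda>b. (\<bar>b - a\<bar> + \<bar>orbit_momentum c b - orbit_momentum c a\<bar>) * ?E)"
      by (intro continuous_intros orbit_momentum_cont)
    then have "((\<lambda>b. (\<bar>b - a\<bar> + \<bar>orbit_momentum c b - orbit_momentum c a\<bar>) * ?E) \<longlongrightarrow> 0) (at a within ?S)"
      using a by (intro tendsto_mult_left_zero) (auto simp: continuous_on dest!: bspec[of _ _ a])
    then have "\<forall>\<^sub>F b in at a within ?S. (\<bar>b - a\<bar> + \<bar>orbit_momentum c b - orbit_momentum c a\<bar>) * ?E < e"
      using e by (rule order_tendstoD)
    then show ?thesis
    proof eventually_elim
      case (elim b)
      show ?case
      proof
        fix t assume t: "t \<in> {t0..s}"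
        have "\<bar>V b t - V a t\<bar> + \<bar>W b t - W a t\<bar>
            \<le> (\<bar>b - a\<bar> + \<bar>orbit_momentum c b - orbit_momentum c a\<bar>) * exp ((1 + N * L) * (t - t0))"
          using trajectory_distance(1)[OF traj[of b] traj[of a], of t0 t] t init by simp
        also have "\<dots> \<le> (\<bar>b - a\<bar> + \<bar>orbit_momentum c b - orbit_momentum c a\<bar>) * ?E"
          using t N_pos L_nonneg by (intro mult_left_mono exp_le_cancel_iff[THEN iffD2]) auto
        finally show "\<bar>V b t - V a t\<bar> < e \<and> \<bar>W b t - W a t\<bar> < e" using elim by linarith
      qed
    qed
  qed
  have turns_open: "\<forall>\<^sub>F b in at a within ?S. turns t0 (V b) (W b)"
    if a: "a \<in> ?S" and t: "turns t0 (V a) (W a)" for a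
  proof -
    obtain s where s: "t0 \<le> s" "W a s < 0" "\<And>t. t \<in> {t0..s} \<Longrightarrow> V a t < 1"
      using t unfolding turns_def by blast
    obtain u where u: "u \<in> {t0..s}" "\<And>t. t \<in> {t0..s} \<Longrightarrow> V a t \<le> V a u"
      using continuous_attains_sup[of "{t0..s}" "V a"] s(1)
        continuous_on_subset[OF V_cont[OF traj], of "{t0..s}"] by auto
    \<comment> \<open>The smallest margin in the strict inequalities defining \<open>turns\<close>
      is the admissible size of the perturbation.\<close>
    have "0 < min (1 - V a u) (- W a s)" using s u by simp
    from close[OF a this, of s] show ?thesis
    proof eventually_elim
      case (elim b)
      have "W b s < 0" using elim[rule_format, of s] s(1) by auto
      moreover have "V b t < 1" if "t \<in> {t0..s}" for t
        using elim[rule_format, OF that] u(2)[OF that] by auto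
      ultimately show ?case unfolding turns_def using s(1) by blast
    qed
  qed
  have overshoots_open: "\<forall>\<^sub>F b in at a within ?S. overshoots t0 (V b) (W b)"
    if a: "a \<in> ?S" and t: "overshoots t0 (V a) (W a)" for a
  proof -
    obtain s where s: "t0 \<le> s" "1 < V a s" "\<And>t. t \<in> {t0..s} \<Longrightarrow> 0 < W a t"
      using t unfolding overshoots_def by blast
    obtain u where u: "u \<in> {t0..s}" "\<And>t. t \<in> {t0..s} \<Longrightarrow> W a u \<le> W a t"
      using continuous_attains_inf[of "{t0..s}" "W a"] s(1)
        continuous_on_subset[OF W_cont[OF traj], of "{t0..s}"] by auto
    have "0 < min (W a u) (V a s - 1)" using s u by simp
    from close[OF a this, of s] show ?thesis
    proof eventually_elim
      case (elim b)
      have "1 < V b s" using elim[rule_format, of s] s(1) by auto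
      moreover have "0 < W b t" if "t \<in> {t0..s}" for t
        using elim[rule_format, OF that] u(2)[OF that] by auto
      ultimately show ?case unfolding overshoots_def using s(1) by blast
    qed
  qed
  have "\<exists>a. \<alpha> \<le> a \<and> a < z \<and> (\<forall>t\<ge>t0. 0 < W a t \<and> V a t < 1)"
  proof (rule ccontr)
    assume "\<not> ?thesis"
    then have fails: "\<exists>t\<ge>t0. W a t \<le> 0 \<or> 1 \<le> V a t" if "\<alpha> \<le> a" "a < z" for a
      using that by force
    have turns_z: "turns t0 (V z) (W z)"
    proof (rule turns_if_stops[OF traj order_refl])
      show "W z t0 = 0" using z init by (simp add: orbit_momentum_def)
      show "V z t < 1" if "t0 \<le> t" "t \<le> t0" for t
        using that init(1)[of z] z(2) by auto
    qed (use z init in auto)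
    have dichotomy: "turns t0 (V a) (W a) \<or> overshoots t0 (V a) (W a)" if a: "a \<in> ?S" for a
    proof (cases "a = z")
      case False
      have "0 < W a t0" using a z \<alpha> False init orbit_momentum_pos[OF c_pos] by auto
      then show ?thesis
        using fails[of a] forward_dichotomy[OF traj, of a] a z init False by force
    qed (use turns_z in simp)
    \<comment> \<open>If no level below \<open>z\<close> succeeded, every level would turn or
      overshoot. Both properties being open and mutually exclusive, turning would be locally
      constant on a connected interval, although \<alpha> and \<open>z\<close> disagree.\<close>
    have "turns t0 (V \<alpha>) (W \<alpha>) = turns t0 (V z) (W z)"
    proof (rule connected_local_const[where A = ?S and f = "\<lambda>a. turns t0 (V a) (W a)"])
      show "\<forall>a\<in>?S. \<forall>\<^sub>F b in at a within ?S. turns t0 (V a) (W a) = turns t0 (V b) (W b)"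
      proof
        fix a assume a: "a \<in> ?S"
        show "\<forall>\<^sub>F b in at a within ?S. turns t0 (V a) (W a) = turns t0 (V b) (W b)"
        proof (cases "turns t0 (V a) (W a)")
          case True
          from turns_open[OF a True] show ?thesis by eventually_elim (use True in simp)
        next
          case False
          then have "overshoots t0 (V a) (W a)" using dichotomy[OF a] by blast
          from overshoots_open[OF a this] show ?thesis
            by eventually_elim (use False not_turns_and_overshoots in blast)
        qed
      qed
    qed (use z in auto)
    then show False using turns_z not_turns_from_\<alpha>[OF traj init] by simp
  qed
  then obtain a where a: "\<alpha> \<le> a" "a < z" "\<And>t. t0 \<le> t \<Longrightarrow> 0 < W a t" "\<And>t. t0 \<le> t \<Longrightarrow> V a t < 1"
    by blast
  show thesis
    using that[OF a(1,2) traj init _ forward_limit[OF traj]] a init by auto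
qed

end

subsection \<open>Gluing the two half-lines\<close>

lemma lipschitz_imp_absolutely_continuous_on:
  assumes lip: "\<And>s t. s \<in> S \<Longrightarrow> t \<in> S \<Longrightarrow> s \<le> t \<Longrightarrow> \<bar>h t - h s\<bar> \<le> C * (t - s)" and C: "0 \<le> C"
  shows "absolutely_continuous_on S h"
  unfolding absolutely_continuous_on_def
proof (intro allI impI)
  fix e :: real assume e: "0 < e"
  \<comment> \<open>The threshold is \<open>e / (C + 1)\<close> rather than \<open>e / C\<close>,
    since \<open>C\<close> may be 0.\<close>
  have "(\<Sum>(a, b)\<in>I. \<bar>h b - h a\<bar>) < e"
    if I: "\<forall>(a, b)\<in>I. a < b \<and> {a..b} \<subseteq> S" and small: "(\<Sum>(a, b)\<in>I. b - a) < e / (C + 1)"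
    for I :: "(real \<times> real) set"
  proof -
    have "(\<Sum>(a, b)\<in>I. \<bar>h b - h a\<bar>) \<le> (\<Sum>(a, b)\<in>I. C * (b - a))"
    proof (rule sum_mono, clarify)
      fix a b assume "(a, b) \<in> I"
      then have "a \<le> b" "a \<in> S" "b \<in> S" using I by fastforce+
      then show "\<bar>h b - h a\<bar> \<le> C * (b - a)" by (intro lip)
    qed
    also have "\<dots> = C * (\<Sum>(a, b)\<in>I. b - a)"
      by (simp add: sum_distrib_left case_prod_unfold)
    also have "\<dots> \<le> C * (e / (C + 1))" using small C by (intro mult_left_mono) auto
    also have "\<dots> < e" using C e by (simp add: field_simps)
    finally show ?thesis .
  qed
  moreover have "0 < e / (C + 1)" using e C by simp
  ultimately show "\<exists>d>0. \<forall>I. finite I \<and> (\<forall>(a, b)\<in>I. a < b \<and> {a..b} \<subseteq> S) \<and>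
      disjoint_family_on (\<lambda>(a, b). {a<..<b}) I \<and> (\<Sum>(a, b)\<in>I. b - a) < d \<longrightarrow>
      (\<Sum>(a, b)\<in>I. \<bar>h b - h a\<bar>) < e"
    by blast
qed

text \<open>The left piece is handed over as a function on \<open>{t0..}\<close> in reversed time,
  which is the form in which \<open>backward_orbit\<close> supplies it.\<close>

definition glue :: "real \<Rightarrow> (real \<Rightarrow> real) \<Rightarrow> (real \<Rightarrow> real) \<Rightarrow> real \<Rightarrow> real" where
  "glue t0 l r t = (if t0 \<le> t then r t else l (2 * t0 - t))"

lemma glue_right: "t0 \<le> t \<Longrightarrow> glue t0 l r t = r t"
  by (simp add: glue_def)

lemma glue_left: "l t0 = r t0 \<Longrightarrow> t \<le> t0 \<Longrightarrow> glue t0 l r t = l (2 * t0 - t)"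
  by (cases "t = t0") (auto simp: glue_def)

lemma DERIV_glue_left:
  assumes "l t0 = r t0" "t \<le> t0" "(l has_real_derivative D) (at (2 * t0 - t) within {t0..})"
  shows "(glue t0 l r has_real_derivative - D) (at t within {..t0})"
proof -
  have "((\<lambda>t. 2 * t0 - t) has_real_derivative - 1) (at t within {..t0})"
    by (auto intro!: derivative_eq_intros)
  moreover have "(l has_real_derivative D) (at (2 * t0 - t) within (\<lambda>t. 2 * t0 - t) ` {..t0})"
    by (rule DERIV_subset[OF assms(3)]) auto
  ultimately have "(l \<circ> (\<lambda>t. 2 * t0 - t) has_real_derivative D * - 1) (at t within {..t0})"
    by (rule DERIV_image_chain[rotated])
  then have "((\<lambda>t. l (2 * t0 - t)) has_real_derivative - D) (at t within {..t0})"
    by (simp add: o_def)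
  then show ?thesis
    by (rule has_field_derivative_transform_within[where d = 1])
       (use assms(1,2) in \<open>auto simp: glue_left\<close>)
qed

lemma DERIV_glue_right:
  assumes "t0 \<le> t" "(r has_real_derivative D) (at t within {t0..})"
  shows "(glue t0 l r has_real_derivative D) (at t within {t0..})"
  using assms(2)
  by (rule has_field_derivative_transform_within[where d = 1]) (use assms(1) in \<open>auto simp: glue_right\<close>)

text \<open>Reversing time changes the sign of the left derivative. At \<open>t0\<close> the two
  one-sided derivatives agree, so the glued function is differentiable there as well.\<close>

lemma DERIV_glue:
  assumes eq: "l t0 = r t0"
    and l: "\<And>t. t0 \<le> t \<Longrightarrow> (l has_real_derivative - D (2 * t0 - t)) (at t within {t0..})"
    and r: "\<And>t. t0 \<le> t \<Longrightarrow> (r has_real_derivative D t) (at t within {t0..})"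
  shows "(glue t0 l r has_real_derivative D t) (at t)"
proof -
  have L: "(glue t0 l r has_real_derivative D t) (at t within {..t0})" if "t \<le> t0"
    using DERIV_glue_left[of l t0 r t "- D t"] eq l[of "2 * t0 - t"] that by simp
  have R: "(glue t0 l r has_real_derivative D t) (at t within {t0..})" if "t0 \<le> t"
    using DERIV_glue_right[OF that r[OF that]] .
  consider "t < t0" | "t0 < t" | "t = t0" by linarith
  then show ?thesis
  proof cases
    case 1
    then show ?thesis using L at_within_interior[of t "{..t0}"] by simp
  next
    case 2
    then show ?thesis using R at_within_interior[of t "{t0..}"] by simp
  next
    case 3
    have "{..t0} \<union> {t0..} = UNIV" by auto
    then show ?thesis
      using L R 3 unfolding has_field_derivative_iff by (blast intro: Lim_Un_univ)
  qed
qed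

lemma glue_lipschitz:
  assumes eq: "l t0 = r t0"
    and l: "\<And>s t. t0 \<le> s \<Longrightarrow> s \<le> t \<Longrightarrow> \<bar>l t - l s\<bar> \<le> C * (t - s)"
    and r: "\<And>s t. t0 \<le> s \<Longrightarrow> s \<le> t \<Longrightarrow> \<bar>r t - r s\<bar> \<le> C * (t - s)"
    and st: "s \<le> t"
  shows "\<bar>glue t0 l r t - glue t0 l r s\<bar> \<le> C * (t - s)"
proof -
  have R: "\<bar>glue t0 l r t - glue t0 l r s\<bar> \<le> C * (t - s)" if "t0 \<le> s" "s \<le> t" for s t
    using r[OF that] that by (simp add: glue_right)
  have L: "\<bar>glue t0 l r t - glue t0 l r s\<bar> \<le> C * (t - s)" if "s \<le> t" "t \<le> t0" for s t
    using l[of "2 * t0 - t" "2 * t0 - s"] that eq by (simp add: glue_left abs_minus_commute)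
  consider "t0 \<le> s" | "t \<le> t0" | "s \<le> t0" "t0 \<le> t" by linarith
  then show ?thesis
  proof cases
    case 3
    have "C * (t0 - s) + C * (t - t0) = C * (t - s)" by (simp add: algebra_simps)
    then show ?thesis using L[of s t0] R[of t0 t] 3 by linarith
  qed (use L R st in auto)
qed

text \<open>As \<open>phi\<close> undoes \<open>psi\<close>, the function
  \<open>phi (deriv v t)\<close> is \<open>w\<close> itself. The Lipschitz bound for
  \<open>w\<close> on the whole line passes to \<open>deriv v\<close> and gives global absolute
  continuity.\<close>

lemma is_solution_if_first_order_system:
  assumes "\<And>t. v t \<in> {0..1}"
    and v: "\<And>t. (v has_real_derivative psi (w t)) (at t)"
    and w: "\<And>s t. s \<le> t \<Longrightarrow> \<bar>w t - w s\<bar> \<le> C * (t - s)" "0 \<le> C"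
    and ae: "AE t in lebesgue. \<exists>D. (w has_real_derivative D) (at t) \<and> \<delta> * D + q t * f (v t) = 0"
  shows "is_solution \<delta> q f v"
proof -
  have dv: "deriv v = (\<lambda>t. psi (w t))" using v by (intro ext DERIV_imp_deriv)
  have "C-lipschitz_on UNIV w"
  proof (rule lipschitz_onI)
    show "dist (w s) (w t) \<le> C * dist s t" for s t
      using w(1)[of s t] w(1)[of t s] by (cases "s \<le> t") (auto simp: dist_real_def abs_minus_commute)
  qed (rule w(2))
  then have "continuous_on UNIV (\<lambda>t. psi (w t))"
    by (intro continuous_on_psi lipschitz_on_continuous_on)
  then have "v C1_differentiable_on UNIV"
    unfolding C1_differentiable_on_def using v
    by (auto simp: has_real_derivative_iff_has_vector_derivative intro!: exI[of _ "\<lambda>t. psi (w t)"])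
  moreover have "absolutely_continuous_on UNIV (deriv v)"
    unfolding dv using w psi_lipschitz order_trans
    by (intro lipschitz_imp_absolutely_continuous_on[of _ _ C]) blast+
  ultimately show ?thesis
    using assms(1) ae abs_psi_less_one unfolding is_solution_def dv by (auto simp: phi_psi)
qed

section \<open>From the essential bounds on \<open>q\<close> to the heteroclinic solution\<close>

lemma Linf_bounds:
  assumes q: "in_Linf {t0<..} q" and lower: "AE t in lebesgue_on {t0<..}. \<eta> \<le> q t"
  defines "N \<equiv> real_of_ereal (Linf_norm {t0<..} q)"
  shows "\<eta> \<le> N" and "AE t in lebesgue. t0 < t \<longrightarrow> \<eta> \<le> q t \<and> q t \<le> N"
proof -
  have "AE t in lebesgue_on {t0<..}. ereal \<bar>q t\<bar> \<le> Linf_norm {t0<..} q"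
    unfolding Linf_norm_def by (rule esssup_AE)
  with lower have "AE t in lebesgue_on {t0<..}. \<eta> \<le> q t \<and> ereal \<bar>q t\<bar> \<le> Linf_norm {t0<..} q"
    by eventually_elim simp
  then have ae: "AE t in lebesgue. t0 < t \<longrightarrow> \<eta> \<le> q t \<and> ereal \<bar>q t\<bar> \<le> Linf_norm {t0<..} q"
    by (subst (asm) AE_restrict_space_iff) auto
  \<comment> \<open>A half-line is not negligible, so the almost-everywhere bounds hold together at
    some point. That point shows that the norm is a genuine real number and is at least
    \<eta>.\<close>
  have "\<exists>t>t0. \<eta> \<le> q t \<and> ereal \<bar>q t\<bar> \<le> Linf_norm {t0<..} q"
  proof (rule ccontr)
    assume none: "\<not> ?thesis"
    have "AE t in lebesgue. t \<notin> {t0<..}" using ae by eventually_elim (use none in auto)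
    then have "{t0<..} \<in> null_sets lebesgue" by (subst AE_iff_null_sets) auto
    then have "negligible {t0<..}" by (simp add: negligible_iff_null_sets)
    moreover have "{t0<..} \<noteq> {}" by simp
    ultimately show False using open_not_negligible[OF open_greaterThan] by blast
  qed
  then obtain t where t: "\<eta> \<le> q t" "ereal \<bar>q t\<bar> \<le> Linf_norm {t0<..} q" by blast
  have N: "Linf_norm {t0<..} q = ereal N"
    using q t(2) unfolding N_def in_Linf_def by (cases "Linf_norm {t0<..} q") auto
  show "\<eta> \<le> N" using t unfolding N by simp
  from ae show "AE t in lebesgue. t0 < t \<longrightarrow> \<eta> \<le> q t \<and> q t \<le> N"
    unfolding N by eventually_elim auto
qed

theorem theorem3p6:
  fixes \<delta> t0 c \<alpha> :: real and q f F :: "real \<Rightarrow> real"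
  assumes "\<delta> > 0"
    and "in_Linf {t0<..} q"
    and "\<exists>\<eta>>0. AE t in lebesgue_on {t0<..}. q t \<ge> \<eta>"
    and "c > 0"
    and "\<forall>t\<le>t0. q t = c"
    and "\<exists>L. L-lipschitz_on {0..1} f"
    and "f 0 = 0" and "f 1 = 0"
    and "\<alpha> \<in> {0<..<1}" and "f \<alpha> = 0"
    and "\<forall>s\<in>{0<..<\<alpha>}. f s < 0"
    and "\<forall>s\<in>{\<alpha><..<1}. f s > 0"
    and "\<forall>u\<in>{0..1}. F u = integral {0..u} f"
    and "F 1 > 0"
    and "c \<ge> real_of_ereal (Linf_norm {t0<..} q) * ((F 1 - F \<alpha>) / (- F \<alpha>))"
  shows "\<exists>v. is_heteroclinic_solution \<delta> q f v"
proof -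
  obtain \<eta> where \<eta>: "0 < \<eta>" and q_lower: "AE t in lebesgue_on {t0<..}. \<eta> \<le> q t"
    using assms(3) by blast
  define N where "N = real_of_ereal (Linf_norm {t0<..} q)"
  note q_bounds = Linf_bounds[OF assms(2) q_lower, folded N_def]
  obtain L where L: "L-lipschitz_on {0..1} f" using assms(6) by blast
  \<comment> \<open>Clamping the argument extends \<open>f\<close> with the same Lipschitz constant;
    as \<open>f\<close> vanishes at 0 and 1, the extension is zero outside the unit
    interval.\<close>
  define g where "g x = f (max 0 (min 1 x))" for x
  have g_eq: "g x = f x" if "x \<in> {0..1}" for x using that by (simp add: g_def)
  interpret bistable g L \<alpha>
  proof
    show "\<bar>g x - g y\<bar> \<le> L * \<bar>x - y\<bar>" for x y
    proof -
      have "\<bar>g x - g y\<bar> \<le> L * \<bar>max 0 (min 1 x) - max 0 (min 1 y)\<bar>"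
        using lipschitz_onD[OF L, of "max 0 (min 1 x)" "max 0 (min 1 y)"] by (simp add: g_def dist_real_def)
      also have "\<dots> \<le> L * \<bar>x - y\<bar>"
        using lipschitz_on_nonneg[OF L] by (intro mult_left_mono) auto
      finally show ?thesis .
    qed
  qed (use assms(7-12) in \<open>auto simp: g_def\<close>)
  have G_eq: "G x = F x" if "x \<in> {0..1}" for x
    using integral_cong[of "{0..x}" g f] g_eq assms(13) that by (auto simp: G_def)
  have G1: "0 < G 1" using G_eq[of 1] assms(14) by simp
  obtain z where z: "\<alpha> < z" "z < 1" "G z = 0" "\<forall>x\<in>{0<..<z}. G x < 0"
    using G_zero_exists[OF G1] by blast

  define q0 where "q0 t = (if t \<in> {t0<..} then q t else 0)" for t
  \<comment> \<open>Where the bounds on \<open>q\<close> fail, and at \<open>t0\<close> itself since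
    \<open>0 < \<eta>\<close>, the value is reset to \<open>N\<close>, which lies in the admissible
    range. To the right of \<open>t0\<close> this changes \<open>q\<close> only on a null
    set.\<close>
  define Q where "Q t = (if \<eta> \<le> q0 t \<and> q0 t \<le> N then q0 t else N) / \<delta>" for t
  have Q_eq: "\<delta> * Q t = q t" if "t0 < t" "\<eta> \<le> q t \<and> q t \<le> N" for t
    using that \<open>\<delta> > 0\<close> by (simp add: Q_def q0_def)
  have "q0 \<in> borel_measurable lebesgue"
    unfolding q0_def by (rule borel_measurable_if_I) (use assms(2) in \<open>auto simp: in_Linf_def\<close>)
  then have "Q \<in> borel_measurable lebesgue"
    unfolding Q_def by simp
  then have Q_meas: "Q \<in> borel_measurable (lebesgue_on {t0..})"
    by (rule measurable_restrict_space1)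
  interpret forward_problem g L \<alpha> Q t0 "\<eta> / \<delta>" "N / \<delta>" "c / \<delta>"
  proof
    show "Q \<in> borel_measurable (lebesgue_on {t0..})" by fact
    show "\<eta> / \<delta> \<le> Q t" "Q t \<le> N / \<delta>" for t
      using q_bounds(1) \<open>\<delta> > 0\<close> by (auto simp: Q_def intro!: divide_right_mono)
    have "N * ((G 1 - G \<alpha>) / (- G \<alpha>)) \<le> c"
      using assms(15) G_eq[of 1] G_eq[of \<alpha>] \<alpha> by (simp add: N_def)
    then have "N * (G 1 - G \<alpha>) \<le> c * (- G \<alpha>)" using G_\<alpha>_neg by (simp add: field_simps)
    then show "N / \<delta> * (G 1 - G \<alpha>) \<le> c / \<delta> * (- G \<alpha>)"
      using \<open>\<delta> > 0\<close> divide_right_mono[of "N * (G 1 - G \<alpha>)" "c * (- G \<alpha>)" \<delta>] by simp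
    show "0 < \<eta> / \<delta>" "0 < c / \<delta>" using \<eta> \<open>\<delta> > 0\<close> \<open>c > 0\<close> by simp_all
  qed
  obtain V W a where a: "\<alpha> \<le> a" "a < z" and traj: "trajectory Q g t0 V W"
    and init: "V t0 = a" "W t0 = orbit_momentum (c / \<delta>) a"
    and VW: "\<forall>t\<ge>t0. 0 < W t \<and> V t < 1" and lim: "(V \<longlongrightarrow> 1) at_top"
    by (rule forward_orbit[OF z])
  have a0: "0 < a" using a \<alpha> by simp
  obtain V' W' where traj': "trajectory (\<lambda>_. c / \<delta>) g t0 V' W'"
    and init': "V' t0 = a" "W' t0 = - orbit_momentum (c / \<delta>) a"
    and VW': "\<forall>t\<ge>t0. 0 < V' t \<and> W' t < 0" and lim': "(V' \<longlongrightarrow> 0) at_top"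
    by (rule backward_orbit[OF c_pos z(3,4) a0 a(2)])
  interpret bwd: lipschitz_system "\<lambda>_. c / \<delta>" g t0 "c / \<delta>" L L
    using c_pos by (intro system_constant) simp

  define v where "v = glue t0 V' V"
  \<comment> \<open>Reversing time back to the past changes the sign of the momentum, hence the
    minus on the left piece.\<close>
  define w where "w = glue t0 (\<lambda>t. - W' t) W"
  have eqV: "V' t0 = V t0" and eqW: "- W' t0 = W t0" using init init' by auto
  have w_pos: "0 < w t" for t
    using VW[rule_format, of t] VW'[rule_format, of "2 * t0 - t"] by (simp add: w_def glue_def)
  have v_deriv: "(v has_real_derivative psi (w t)) (at t)" for t
    unfolding v_def
  proof (rule DERIV_glue[of V' t0 V, OF eqV])
    show "(V' has_real_derivative - psi (w (2 * t0 - t))) (at t within {t0..})" if "t0 \<le> t" for t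
      using bwd.V_deriv[OF traj' that] eqW that by (simp add: w_def glue_left)
    show "(V has_real_derivative psi (w t)) (at t within {t0..})" if "t0 \<le> t" for t
      using V_deriv[OF traj that] that by (simp add: w_def glue_right)
  qed
  have v_mono: "strict_mono v"
  proof (rule strict_monoI)
    show "v s < v t" if "s < t" for s t
      using that by (rule DERIV_pos_imp_increasing) (use v_deriv w_pos psi_pos_iff in blast)
  qed
  have v_range: "v t \<in> {0..1}" for t
  proof -
    have "0 < v t"
    proof (cases "t \<le> t0")
      case True
      then show ?thesis using VW'[rule_format, of "2 * t0 - t"] eqV by (simp add: v_def glue_left)
    next
      case False
      then have "v t0 < v t" using strict_monoD[OF v_mono] by simp
      then show ?thesis using VW'[rule_format, of t0] eqV by (simp add: v_def glue_right)
    qed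
    moreover have "v t < 1"
    proof (cases "t0 \<le> t")
      case True
      then show ?thesis using VW[rule_format, of t] by (simp add: v_def glue_right)
    next
      case False
      then have "v t < v t0" using strict_monoD[OF v_mono] by simp
      then show ?thesis using VW[rule_format, of t0] by (simp add: v_def glue_right)
    qed
    ultimately show ?thesis by simp
  qed
  define C where "C = max (N / \<delta> * L) (c / \<delta> * L)"
  have w_lip: "\<bar>w t - w s\<bar> \<le> C * (t - s)" if "s \<le> t" for s t
    unfolding w_def
  proof (rule glue_lipschitz[of "\<lambda>t. - W' t" t0 W, OF eqW _ _ that])
    fix s t assume st: "t0 \<le> s" "s \<le> t"
    show "\<bar>- W' t - - W' s\<bar> \<le> C * (t - s)"
      using bwd.W_lipschitz[OF traj' st] mult_right_mono[of "c / \<delta> * L" C "t - s"] st by (simp add: C_def)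
    show "\<bar>W t - W s\<bar> \<le> C * (t - s)"
      using W_lipschitz[OF traj st] mult_right_mono[of "N / \<delta> * L" C "t - s"] st by (simp add: C_def)
  qed
  \<comment> \<open>The coefficient may jump at \<open>t0\<close>, so the one-sided derivatives of
    \<open>w\<close> may differ there; a single point is null.\<close>
  have "AE t in lebesgue. t \<noteq> t0" by (rule AE_I'[of "{t0}"]) auto
  with q_bounds(2) W_deriv_AE[OF traj]
  have ae: "AE t in lebesgue. \<exists>D. (w has_real_derivative D) (at t) \<and> \<delta> * D + q t * f (v t) = 0"
  proof eventually_elim
    case (elim t)
    show "\<exists>D. (w has_real_derivative D) (at t) \<and> \<delta> * D + q t * f (v t) = 0"
    proof (cases "t0 < t")
      case True
      then have "(W has_real_derivative - (Q t * g (V t))) (at t)" using elim by blast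
      then have "(w has_real_derivative - (Q t * g (V t))) (at t)"
        by (rule has_field_derivative_transform_within_open[where S = "{t0<..}"])
           (use True in \<open>simp_all add: w_def glue_right\<close>)
      moreover have "\<delta> * - (Q t * g (V t)) + q t * f (v t) = 0"
      proof -
        have "\<delta> * Q t = q t" using Q_eq[OF True] elim True by blast
        moreover have "g (V t) = f (v t)" using g_eq[OF v_range[of t]] True by (simp add: v_def glue_right)
        ultimately show ?thesis by (simp flip: mult.assoc)
      qed
      ultimately show ?thesis by blast
    next
      case False
      then have t: "t < t0" using elim by simp
      have "((\<lambda>t. - W' t) has_real_derivative - (- (c / \<delta> * g (V' (2 * t0 - t))))) (at (2 * t0 - t) within {t0..})"
        using bwd.W_deriv[OF traj', of "2 * t0 - t"] t by (intro DERIV_minus) auto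
      from DERIV_glue_left[of "\<lambda>t. - W' t" t0 W, OF eqW _ this] t
      have "(w has_real_derivative - (c / \<delta> * g (v t))) (at t within {..t0})"
        using eqV by (simp add: w_def v_def glue_left)
      then have "(w has_real_derivative - (c / \<delta> * g (v t))) (at t)"
        using at_within_interior[of t "{..t0}"] t by simp
      moreover have "\<delta> * - (c / \<delta> * g (v t)) + q t * f (v t) = 0"
        using t assms(5) g_eq[OF v_range[of t]] \<open>\<delta> > 0\<close> by simp
      ultimately show ?thesis by blast
    qed
  qed
  have "0 \<le> C" using mult_nonneg_nonneg[OF less_imp_le[OF c_pos] L_nonneg] unfolding C_def le_max_iff_disj by blast
  then have "is_solution \<delta> q f v"
    using v_range v_deriv w_lip ae by (intro is_solution_if_first_order_system)
  moreover have "(v \<longlongrightarrow> 0) at_bot"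
  proof -
    have "filterlim (\<lambda>t. 2 * t0 + - t) at_top at_bot"
      by (rule filterlim_tendsto_add_at_top[OF tendsto_const filterlim_uminus_at_top_at_bot])
    then have "((\<lambda>t. V' (2 * t0 - t)) \<longlongrightarrow> 0) at_bot"
      using filterlim_compose[OF lim'] by fastforce
    moreover have "\<forall>\<^sub>F t in at_bot. V' (2 * t0 - t) = v t"
      using eventually_le_at_bot[of t0] by eventually_elim (simp add: v_def glue_left eqV)
    ultimately show ?thesis by (rule Lim_transform_eventually)
  qed
  moreover have "(v \<longlongrightarrow> 1) at_top"
  proof (rule Lim_transform_eventually[OF lim])
    show "\<forall>\<^sub>F t in at_top. V t = v t"
      using eventually_ge_at_top[of t0] by eventually_elim (simp add: v_def glue_right)
  qed
  ultimately show ?thesis using v_mono unfolding is_heteroclinic_solution_def by blast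
qed

end
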